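(* Consider one of the three models ASEP, GZRP, BLP, with coupled generator $L$ on pairs $(\underline\omega,\underline\zeta)$, and for $j\in\mathbb Z$ let $\underline\nu_j$ be the product shock measure with a single second class particle at $j$, with left marginal, right marginal and marginal $\hat\mu$ at $j$ (all as defined in the context). The identity $$\frac{\mathrm d}{\mathrm dt}\,\underline\nu_jS(t)\Bigr|_{t=0}=P\cdot[\underline\nu_{j+1}-\underline\nu_j]+Q\cdot[\underline\nu_{j-1}-\underline\nu_j]$$ holds for every $j\in\mathbb Z$, in the sense of test functions, in each of the following cases. (i) ASEP with left density $\varrho\in(0,1)$ and right density $\lambda\in(0,1)$, if $$\frac{\lambda(1-\varrho)}{\varrho(1-\lambda)}=\frac pq\qquad\text{and}\qquad \hat\mu(0)=1.$$ In this case $$P=\frac{1-\lambda}{1-\varrho}\,p=\frac{\lambda}{\varrho}\,q=(1-\lambda)p+\lambda q,\qquad Q=\frac{1-\varrho}{1-\lambda}\,q=\frac{\varrho}{\lambda}\,p=(1-\varrho)q+\varrho p.$$ (ii) GZRP with parameters $\theta,\sigma\in\mathbb R$ on the left and right, if $\theta-\sigma=\beta$ and $\hat\mu(y)=\mu^\sigma(y)$ for all $y\in\mathbb Z$. In this case $P=e^{\theta}-e^{\sigma}$ and $Q=0$. (iii) BLP with parameters $\theta,\sigma\in\mathbb R$ on the left and right, if $\theta-\sigma=\beta$ and $\hat\mu(y)=\mu^\sigma(y)$ for all $y\in\mathbb Z$. In this case $P=e^{\theta}-e^{\sigma}$ and $Q=e^{-\sigma}-e^{-\theta}$.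
   Context: Models. Configurations are $\underline\omega\in I^{\mathbb Z}$. For $i\neq j$, $\underline\omega^{i,j}$ is the configuration obtained from $\underline\omega$ by replacing $\omega_i$ by $\omega_i-1$ and $\omega_j$ by $\omega_j+1$. The process jumps $\underline\omega\to\underline\omega^{i,i+1}$ with rate $p(\omega_i,\omega_{i+1})$ and $\underline\omega\to\underline\omega^{i+1,i}$ with rate $q(\omega_i,\omega_{i+1})$, for every $i\in\mathbb Z$. - ASEP: $I=\{0,1\}$, $p(y,z)=p\cdot\mathbf 1\{y=1,z=0\}$, $q(y,z)=q\cdot\mathbf 1\{y=0,z=1\}$, with reals $p>q\ge 0$, $p+q=1$ (and $q>0$ wherever $p/q$ occurs). - GZRP (generalized totally asymmetric exponential zero range process): $I=\mathbb Z$, $p(y,z)=f(y)$, $q\equiv0$, with $f(y)=e^{\beta(y-1/2)}$, $\beta>0$. - BLP (totally asymmetric exponential bricklayers process): $I=\mathbb Z$, $p(y,z)=f(y)+f(-z)$, $q\equiv 0$, with the same $f$. Stationary one-site marginals. For ASEP with density $\varrho\in(0,1)$: $\mu(1)=1-\mu(0)=\varrho$. For GZRP and BLP with parameter $\theta\in\mathbb R$: $\mu^\theta(z)=\frac{1}{Z(\theta)}e^{\theta z-\beta z^2/2}$, $z\in\mathbb Z$, where $Z(\theta)=\sum_{z\in\mathbb Z}e^{\theta z-\beta z^2/2}$. Coupled dynamics (basic coupling). For pairs with $\omega_i\le\zeta_i$ for all $i$, and $\varphi$ a function depending on finitely many coordinates of the pair (a finite cylinder function), $$\begin{aligned}(L\varphi)(\underline\omega,\underline\zeta)=\sum_{i\in\mathbb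 Z}\Bigl\{&p(\omega_i,\zeta_{i+1})[\varphi(\underline\omega^{i,i+1},\underline\zeta^{i,i+1})-\varphi(\underline\omega,\underline\zeta)]\\&+[p(\omega_i,\omega_{i+1})-p(\omega_i,\zeta_{i+1})][\varphi(\underline\omega^{i,i+1},\underline\zeta)-\varphi(\underline\omega,\underline\zeta)]\\&+[p(\zeta_i,\zeta_{i+1})-p(\omega_i,\zeta_{i+1})][\varphi(\underline\omega,\underline\zeta^{i,i+1})-\varphi(\underline\omega,\underline\zeta)]\\&+q(\zeta_i,\omega_{i+1})[\varphi(\underline\omega^{i+1,i},\underline\zeta^{i+1,i})-\varphi(\underline\omega,\underline\zeta)]\\&+[q(\zeta_i,\zeta_{i+1})-q(\zeta_i,\omega_{i+1})][\varphi(\underline\omega,\underline\zeta^{i+1,i})-\varphi(\underline\omega,\underline\zeta)]\\&+[q(\omega_i,\omega_{i+1})-q(\zeta_i,\omega_{i+1})][\varphi(\underline\omega^{i+1,i},\underline\zeta)-\varphi(\underline\omega,\underline\zeta)]\Bigr\}\end{aligned}$$ (only finitely many terms are nonzero; terms with zero rate are taken to be zero). There is one second class particle at site $j$ if $\zeta_j=\omega_j+1$ and $\zeta_i=\omega_i$ for $i\ne j$. Shock measures. Let $\mu^{\rm left}$ be $\mu^\theta$ (for ASEP the marginal of density $\varrho$) and $\mu^{\rm right}$ be $\mu^\sigma$ (for ASEP the marginal of density $\lambda$), and let $\hat\mu$ be a probability measure on $I$, with $\hat\mu(1)=0$ for ASEP. The measure $\underline\nu_j$ on pairs $(\underline\omega,\underline\zeta)$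 is the product over sites $i\in\mathbb Z$ under which: for $i<j$, $\zeta_i=\omega_i$ with $\omega_i\sim\mu^{\rm left}$; for $i=j$, $\zeta_j=\omega_j+1$ with $\omega_j\sim\hat\mu$; for $i>j$, $\zeta_i=\omega_i$ with $\omega_i\sim\mu^{\rm right}$. Meaning of the identity. $\underline\nu S(t)$ is the law of the coupled pair at time $t$ started from $\underline\nu$. It is a standing assumption that the dynamics exists, with the usual properties of semigroup and generator. The identity "in the sense of test functions" means that for every bounded finite cylinder function $\varphi$ of the pair, $\frac{\mathrm d}{\mathrm dt}\int\varphi\,\mathrm d(\underline\nu_jS(t))\big|_{t=0}=\int L\varphi\,\mathrm d\underline\nu_j$ equals $P\bigl[\int\varphi\,\mathrm d\underline\nu_{j+1}-\int\varphi\,\mathrm d\underline\nu_j\bigr]+Q\bigl[\int\varphi\,\mathrm d\underline\nu_{j-1}-\int\varphi\,\mathrm d\underline\nu_j\bigr]$. *)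

theory Defs
  imports "HOL-Probability.Probability"
begin

text \<open>
  All models use configurations in \<^typ>\<open>int \<Rightarrow> int\<close>; the first \<^typ>\<open>int\<close> is the lattice.
  For ASEP the spin space \<open>{0, 1}\<close> is enforced by the one-site marginals and by the rates,
  which vanish off \<open>{0, 1}\<close>.
\<close>

type_synonym config = "int \<Rightarrow> int"
type_synonym rate = "int \<Rightarrow> int \<Rightarrow> real"

definition jump :: "config \<Rightarrow> int \<Rightarrow> int \<Rightarrow> config" where
  "jump \<omega> i j = \<omega> (i := \<omega> i - 1, j := \<omega> j + 1)"

definition asep_p :: "real \<Rightarrow> rate" where
  "asep_p p y z = (if y = 1 \<and> z = 0 then p else 0)"

definition asep_q :: "real \<Rightarrow> rate" where
  "asep_q q y z = (if y = 0 \<and> z = 1 then q else 0)"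

definition exp_rate :: "real \<Rightarrow> int \<Rightarrow> real" where
  "exp_rate \<beta> y = exp (\<beta> * (of_int y - 1 / 2))"

definition gzrp_p :: "real \<Rightarrow> rate" where
  "gzrp_p \<beta> y z = exp_rate \<beta> y"

definition blp_p :: "real \<Rightarrow> rate" where
  "blp_p \<beta> y z = exp_rate \<beta> y + exp_rate \<beta> (- z)"

definition no_rate :: rate where
  "no_rate y z = 0"

definition asep_marginal :: "real \<Rightarrow> int pmf" where
  "asep_marginal \<rho> = map_pmf of_bool (bernoulli_pmf \<rho>)"

definition gauss_weight :: "real \<Rightarrow> real \<Rightarrow> int \<Rightarrow> real" where
  "gauss_weight \<beta> \<theta> z = exp (\<theta> * of_int z - \<beta> * (of_int z)\<^sup>2 / 2)"

definition gauss_norm :: "real \<Rightarrow> real \<Rightarrow> real" where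
  "gauss_norm \<beta> \<theta> = (\<Sum>\<^sub>\<infinity>z\<in>UNIV. gauss_weight \<beta> \<theta> z)"

definition gauss_marginal :: "real \<Rightarrow> real \<Rightarrow> int pmf" where
  "gauss_marginal \<beta> \<theta> = embed_pmf (\<lambda>z. gauss_weight \<beta> \<theta> z / gauss_norm \<beta> \<theta>)"

text \<open>
  The basic coupling. The first component of the pair is the lower configuration \<open>\<omega>\<close>. For a
  cylinder function only finitely many summands are nonzero, so the infinite sum is a finite one.
\<close>

definition coupled_gen ::
  "rate \<Rightarrow> rate \<Rightarrow> (config \<times> config \<Rightarrow> real) \<Rightarrow> config \<times> config \<Rightarrow> real" where
  "coupled_gen p q \<phi> = (\<lambda>(\<omega>, \<zeta>). \<Sum>\<^sub>\<infinity>i\<in>UNIV.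
      p (\<omega> i) (\<zeta> (i+1))
        * (\<phi> (jump \<omega> i (i+1), jump \<zeta> i (i+1)) - \<phi> (\<omega>, \<zeta>))
    + (p (\<omega> i) (\<omega> (i+1)) - p (\<omega> i) (\<zeta> (i+1)))
        * (\<phi> (jump \<omega> i (i+1), \<zeta>) - \<phi> (\<omega>, \<zeta>))
    + (p (\<zeta> i) (\<zeta> (i+1)) - p (\<omega> i) (\<zeta> (i+1)))
        * (\<phi> (\<omega>, jump \<zeta> i (i+1)) - \<phi> (\<omega>, \<zeta>))
    + q (\<zeta> i) (\<omega> (i+1))
        * (\<phi> (jump \<omega> (i+1) i, jump \<zeta> (i+1) i) - \<phi> (\<omega>, \<zeta>))
    + (q (\<zeta> i) (\<zeta> (i+1)) - q (\<zeta> i) (\<omega> (i+1)))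
        * (\<phi> (\<omega>, jump \<zeta> (i+1) i) - \<phi> (\<omega>, \<zeta>))
    + (q (\<omega> i) (\<omega> (i+1)) - q (\<zeta> i) (\<omega> (i+1)))
        * (\<phi> (jump \<omega> (i+1) i, \<zeta>) - \<phi> (\<omega>, \<zeta>)))"

text \<open>
  Test functions are total on pairs of integer configurations. A bounded cylinder function given
  only on ordered pairs, or on \<open>{0, 1}\<close>-valued ones, extends to such a function, and the shock
  measures and the generator do not see the extension.
\<close>

definition finite_cylinder :: "(config \<times> config \<Rightarrow> real) \<Rightarrow> bool" where
  "finite_cylinder \<phi> \<longleftrightarrow> (\<exists>A. finite A \<and>
     (\<forall>\<omega> \<zeta> \<omega>' \<zeta>'. (\<forall>i\<in>A. \<omega> i = \<omega>' i \<and> \<zeta> i = \<zeta>' i) \<longrightarrow> \<phi> (\<omega>, \<zeta>) = \<phi> (\<omega>', \<zeta>')))"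

definition test_function :: "(config \<times> config \<Rightarrow> real) \<Rightarrow> bool" where
  "test_function \<phi> \<longleftrightarrow> finite_cylinder \<phi> \<and> bounded (range \<phi>)"

definition config_space :: "config measure" where
  "config_space = (\<Pi>\<^sub>M i\<in>UNIV. count_space UNIV)"

definition pair_space :: "(config \<times> config) measure" where
  "pair_space = config_space \<Otimes>\<^sub>M config_space"

definition shock_site :: "int pmf \<Rightarrow> int pmf \<Rightarrow> int pmf \<Rightarrow> int \<Rightarrow> int \<Rightarrow> (int \<times> int) pmf" where
  "shock_site left right hat j i =
     (if i < j then map_pmf (\<lambda>x. (x, x)) left
      else if i = j then map_pmf (\<lambda>x. (x, x + 1)) hat
      else map_pmf (\<lambda>x. (x, x)) right)"

definition shock_measure ::
  "int pmf \<Rightarrow> int pmf \<Rightarrow> int pmf \<Rightarrow> int \<Rightarrow> (config \<times> config) measure" where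
  "shock_measure left right hat j =
     distr (\<Pi>\<^sub>M i\<in>UNIV. measure_pmf (shock_site left right hat j i)) pair_space
       (\<lambda>\<eta>. (fst \<circ> \<eta>, snd \<circ> \<eta>))"

text \<open>
  The standing assumption on the dynamics: \<open>K t x\<close> is the law at time \<open>t\<close> of the coupled pair
  started from \<open>x\<close>, so that \<open>\<nu> \<bind> K t\<close> is \<open>\<nu> S(t)\<close>. The rates of the zero range and
  bricklayers models are unbounded, so the generator relation is not required pointwise nor
  for all initial laws, but only, integrated, for the initial laws in \<open>N\<close>.
\<close>

definition coupled_dynamics ::
  "rate \<Rightarrow> rate \<Rightarrow> (config \<times> config) measure set \<Rightarrow>
   (real \<Rightarrow> config \<times> config \<Rightarrow> (config \<times> config) measure) \<Rightarrow> bool" where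
  "coupled_dynamics p q N K \<longleftrightarrow>
     (\<forall>t\<ge>0. K t \<in> pair_space \<rightarrow>\<^sub>M prob_algebra pair_space) \<and>
     (\<forall>x. K 0 x = return pair_space x) \<and>
     (\<forall>s\<ge>0. \<forall>t\<ge>0. \<forall>x. K (s + t) x = K s x \<bind> K t) \<and>
     (\<forall>\<nu>\<in>N. \<forall>\<phi>. test_function \<phi> \<longrightarrow>
        ((\<lambda>t. \<integral>x. \<phi> x \<partial>(\<nu> \<bind> K t)) has_real_derivative (\<integral>x. coupled_gen p q \<phi> x \<partial>\<nu>))
          (at 0 within {0..}))"

text \<open>
  The evolution identity for a family \<open>\<nu>\<close> in the sense of test functions: for the generator, and
  for the time derivative at \<open>0\<close> under any version of the dynamics. Integrability is stated since
  the Bochner integral of a non-integrable function is \<open>0\<close>.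
\<close>

definition shock_identity ::
  "rate \<Rightarrow> rate \<Rightarrow> (int \<Rightarrow> (config \<times> config) measure) \<Rightarrow> real \<Rightarrow> real \<Rightarrow> bool" where
  "shock_identity p q \<nu> P Q \<longleftrightarrow>
     (\<forall>j \<phi>. test_function \<phi> \<longrightarrow>
        (let rhs = P * ((\<integral>x. \<phi> x \<partial>\<nu> (j + 1)) - (\<integral>x. \<phi> x \<partial>\<nu> j))
                 + Q * ((\<integral>x. \<phi> x \<partial>\<nu> (j - 1)) - (\<integral>x. \<phi> x \<partial>\<nu> j))
         in integrable (\<nu> j) (coupled_gen p q \<phi>) \<and>
            (\<integral>x. coupled_gen p q \<phi> x \<partial>\<nu> j) = rhs \<and>
            (\<forall>K. coupled_dynamics p q (range \<nu>) K \<longrightarrow>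
               ((\<lambda>t. \<integral>x. \<phi> x \<partial>(\<nu> j \<bind> K t)) has_real_derivative rhs)
                 (at 0 within {0..}))))"

text \<open>The marginals and shock measures are well defined.\<close>

lemma gauss_weight_summable:
  assumes "\<beta> > 0"
  shows "gauss_weight \<beta> \<theta> summable_on UNIV"
proof -
  define C where "C = (\<bar>\<theta>\<bar> + 1)\<^sup>2 / (2 * \<beta>)"
  define h :: "int \<Rightarrow> real" where "h z = exp C * exp (-1) ^ nat \<bar>z\<bar>" for z
  have le: "gauss_weight \<beta> \<theta> z \<le> h z" for z
  proof -
    let ?x = "\<bar>real_of_int z\<bar>"
    have "0 \<le> (\<beta> * ?x - (\<bar>\<theta>\<bar> + 1))\<^sup>2 / (2 * \<beta>)" using assms by simp
    also have "\<dots> = \<beta> * ?x\<^sup>2 / 2 - (\<bar>\<theta>\<bar> + 1) * ?x + C"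
      using assms by (simp add: C_def field_simps power2_eq_square)
    finally have "(\<bar>\<theta>\<bar> + 1) * ?x \<le> \<beta> * ?x\<^sup>2 / 2 + C" by simp
    moreover have "\<theta> * of_int z \<le> \<bar>\<theta>\<bar> * ?x" by (metis abs_ge_self abs_mult)
    ultimately have "\<theta> * of_int z - \<beta> * (of_int z)\<^sup>2 / 2 \<le> C + - ?x"
      by (simp add: algebra_simps)
    hence "gauss_weight \<beta> \<theta> z \<le> exp (C + - ?x)" by (simp add: gauss_weight_def)
    also have "exp (C + - ?x) = h z"
      unfolding h_def exp_add exp_of_nat_mult[symmetric] by simp
    finally show ?thesis .
  qed
  have geo: "(\<lambda>n::nat. exp C * exp (-1::real) ^ n) summable_on UNIV"
    by (intro norm_summable_imp_summable_on) (simp add: abs_mult summable_mult summable_geometric)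
  have "h summable_on range int"
    by (subst summable_on_reindex) (use geo in \<open>auto simp: o_def h_def\<close>)
  moreover have "h summable_on range (\<lambda>n. - int n)"
    by (subst summable_on_reindex) (use geo in \<open>auto simp: o_def h_def inj_on_def\<close>)
  ultimately have "h summable_on (range int \<union> range (\<lambda>n. - int n))"
    by (rule summable_on_union)
  moreover have "range int \<union> range (\<lambda>n. - int n) = UNIV"
  proof (intro set_eqI iffI UNIV_I)
    fix z :: int
    show "z \<in> range int \<union> range (\<lambda>n. - int n)" by (cases z rule: int_cases2) auto
  qed
  ultimately have "h summable_on UNIV" by simp
  thus ?thesis
    by (rule summable_on_comparison_test) (auto simp: le, simp add: gauss_weight_def)
qed

lemma pmf_gauss_marginal:
  assumes "\<beta> > 0"
  shows "pmf (gauss_marginal \<beta> \<theta>) z = gauss_weight \<beta> \<theta> z / gauss_norm \<beta> \<theta>"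
proof -
  let ?w = "gauss_weight \<beta> \<theta>" and ?Z = "gauss_norm \<beta> \<theta>"
  have pos: "?w x > 0" for x by (simp add: gauss_weight_def)
  have sm: "?w summable_on UNIV" by (rule gauss_weight_summable[OF assms])
  have Zpos: "?Z > 0"
  proof -
    have "?Z \<noteq> 0"
      using nonneg_infsum_le_0D[of ?w UNIV 0] sm pos less_imp_le[OF pos]
      by (metis UNIV_I gauss_norm_def less_irrefl order_refl)
    moreover have "?Z \<ge> 0" unfolding gauss_norm_def by (intro infsum_nonneg less_imp_le pos)
    ultimately show ?thesis by simp
  qed
  have abs: "Infinite_Set_Sum.abs_summable_on ?w UNIV"
    using sm pos by (simp add: abs_summable_equivalent[symmetric] less_imp_le abs_of_pos)
  have "(\<integral>\<^sup>+x. ennreal (?w x / ?Z) \<partial>count_space UNIV)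
      = (\<integral>\<^sup>+x. ennreal (?w x) \<partial>count_space UNIV) / ennreal ?Z"
    using Zpos pos by (subst nn_integral_divide[symmetric])
      (auto simp: divide_ennreal less_imp_le)
  also have "(\<integral>\<^sup>+x. ennreal (?w x) \<partial>count_space UNIV) = ennreal ?Z"
    using nn_integral_conv_infsetsum[OF abs] pos infsetsum_infsum[OF abs]
    by (simp add: gauss_norm_def less_imp_le)
  also have "ennreal ?Z / ennreal ?Z = 1"
    using Zpos by (simp add: divide_ennreal)
  finally show ?thesis
    unfolding gauss_marginal_def
    by (intro pmf_embed_pmf) (use Zpos pos in \<open>auto simp: less_imp_le\<close>)
qed

lemma unzip_measurable:
  "(\<lambda>\<eta>. (fst \<circ> \<eta>, snd \<circ> \<eta>))
     \<in> (\<Pi>\<^sub>M i\<in>UNIV. measure_pmf (shock_site left right hat j i)) \<rightarrow>\<^sub>M pair_space"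
  unfolding pair_space_def config_space_def o_def
  by (intro measurable_Pair measurable_PiM_single')
    (auto intro!: measurable_compose[OF measurable_component_singleton])

lemma prob_space_shock_measure: "prob_space (shock_measure left right hat j)"
  unfolding shock_measure_def
  by (intro prob_space.prob_space_distr unzip_measurable prob_space_PiM prob_space_measure_pmf)

end

theory Submission
  imports Defs
begin

text \<open>
  Each summand of the generator moves particles across one bond \<open>(i, i + 1)\<close> and sees the rest of the
  configuration only through the test function. Since the shock measure is a product, its integral
  against such a summand is computed on the two sites of the bond, with all other sites frozen
  (\<open>expectation_two_sites\<close>). On two sites the computation is a change of measure. In the
  exponential models \<open>f(z) \<mu>\<^sup>\<theta>(z) = e\<^sup>\<theta> \<mu>\<^sup>\<theta>\<^sup>+\<^sup>\<beta>(z)\<close>, and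
  \<open>\<mu>\<^sup>\<theta>\<^sup>+\<^sup>\<beta>\<close> is \<open>\<mu>\<^sup>\<theta>\<close> translated by one, so that a rate at a site amounts to a factor \<open>e\<^sup>\<theta>\<close> and one
  extra particle there. In the exclusion process the gain and loss terms of a jump combine to the
  factor \<open>(p - q) \<rho>\<close> and a particle pinned at the site.

  Hence a bond inside the left phase contributes \<open>a (T\<^sub>i\<^sub>+\<^sub>1 - T\<^sub>i)\<close>, where \<open>T\<^sub>i\<close> is the
  expectation of the test function after the marginal at \<open>i\<close> is replaced by its tilted version, and
  likewise with another constant \<open>b\<close> in the right phase. These sums telescope. At a site which the
  test function does not see the replacement has no effect, so the far ends give multiples
  of the expectation under the shock measure itself. What is left is at the two bonds next to the
  second class particle. There the relation \<open>\<theta> = \<sigma> + \<beta>\<close> makes the tilted marginal at the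
  discrepancy, once the discrepancy has jumped off, equal to the marginal of the phase that
  takes over the site, while the site where it arrives carries \<open>\<mu>\<^sup>\<sigma>\<close> again: the result is a
  translated shock measure. In the exclusion process the condition on the densities plays
  the same part, as it makes the weights of the configurations behind the discrepancy proportional
  to the density of the phase that takes over. Lemma \<open>shock_evolution\<close> does this
  bookkeeping once for all models, from four identities on two sites; the models enter only
  through these.

  The bricklayers rate \<open>f(y) + f(-z)\<close> is a sum of two rates, the first moving the shock to the right
  and the second to the left. The generator is linear in the rates, so the two are treated
  separately and added.
\<close>

section \<open>Integrating out two sites of a product measure\<close>

type_synonym site = "int \<times> int"

lemma measure_pair_pmf:
  fixes A :: "'a::countable pmf" and B :: "'b::countable pmf"
  shows "measure_pmf A \<Otimes>\<^sub>M measure_pmf B = measure_pmf (pair_pmf A B)"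
proof (rule measure_eqI_countable[of _ UNIV])
  show "sets (measure_pmf A \<Otimes>\<^sub>M measure_pmf B) = Pow UNIV"
  proof -
    have "sets (measure_pmf A \<Otimes>\<^sub>M measure_pmf B)
        = sets (count_space (UNIV :: 'a set) \<Otimes>\<^sub>M count_space (UNIV :: 'b set))"
      by (intro sets_pair_measure_cong) auto
    also have "\<dots> = Pow UNIV"
      by (subst pair_measure_countable) auto
    finally show ?thesis .
  qed
  fix z :: "'a \<times> 'b"
  have "emeasure (measure_pmf A \<Otimes>\<^sub>M measure_pmf B) ({fst z} \<times> {snd z})
      = emeasure A {fst z} * emeasure B {snd z}"
    by (intro measure_pmf.emeasure_pair_measure_Times) auto
  also have "\<dots> = pmf (pair_pmf A B) z"
    by (cases z) (simp add: pmf_pair emeasure_pmf_single ennreal_mult)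
  finally show "emeasure (measure_pmf A \<Otimes>\<^sub>M measure_pmf B) {z} = emeasure (pair_pmf A B) {z}"
    by (cases z) (simp add: emeasure_pmf_single)
qed auto

definition field_law :: "(int \<Rightarrow> site pmf) \<Rightarrow> (int \<Rightarrow> site) measure" where
  "field_law S = (\<Pi>\<^sub>M i\<in>UNIV. measure_pmf (S i))"

definition rest_law :: "(int \<Rightarrow> site pmf) \<Rightarrow> int \<Rightarrow> int \<Rightarrow> (int \<Rightarrow> site) measure" where
  "rest_law S i k = (\<Pi>\<^sub>M l\<in>-{i, k}. measure_pmf (S l))"

lemma prob_space_field_law: "prob_space (field_law S)"
  and prob_space_rest_law: "prob_space (rest_law S i k)"
  unfolding field_law_def rest_law_def by (intro prob_space_PiM prob_space_measure_pmf)+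

lemma two_site_measurable:
  "(\<lambda>((x, y), \<eta>). \<eta>(i := x, k := y))
     \<in> measure_pmf (pair_pmf A B) \<Otimes>\<^sub>M rest_law S i k \<rightarrow>\<^sub>M field_law S"
proof -
  have "(\<lambda>z. ((snd z)(i := fst (fst z), k := snd (fst z))) l)
      \<in> measure_pmf (pair_pmf A B) \<Otimes>\<^sub>M rest_law S i k \<rightarrow>\<^sub>M measure_pmf (S l)" for l
  proof -
    consider "l = k" | "l = i" "l \<noteq> k" | "l \<in> -{i, k}" by auto
    thus ?thesis
    proof cases
      case 3
      then show ?thesis unfolding rest_law_def
        by (auto intro!: measurable_compose[OF measurable_snd measurable_component_singleton])
    qed (auto intro!: measurable_compose[OF measurable_fst])
  qed
  thus ?thesis unfolding field_law_def case_prod_beta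
    by (intro measurable_PiM_single') (auto simp: space_PiM)
qed

text \<open>
  The two singled out sites are kept together as one random variable with a discrete law, so that
  identities between laws on pairs of sites can be applied under the integral over the rest.
\<close>

lemma field_law_two_sites:
  assumes "i \<noteq> k"
  shows "field_law S = distr (measure_pmf (pair_pmf (S i) (S k)) \<Otimes>\<^sub>M rest_law S i k) (field_law S)
           (\<lambda>((x, y), \<eta>). \<eta>(i := x, k := y))" (is "_ = distr ?PM _ ?T")
proof -
  note T = two_site_measurable[of i k "S i" "S k" S]
  interpret rest: prob_space "rest_law S i k" by (rule prob_space_rest_law)
  have "(\<Pi>\<^sub>M i\<in>UNIV. measure_pmf (S i)) = distr ?PM (field_law S) ?T"
  proof (rule measure_eqI_PiM_infinite[OF refl])
    show "finite_measure (\<Pi>\<^sub>M i\<in>UNIV. measure_pmf (S i))"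
      using prob_space_field_law[of S] unfolding field_law_def by (simp add: prob_space_def)
    fix J :: "int set" and A :: "int \<Rightarrow> site set" assume J: "finite J"
    let ?X = "prod_emb UNIV (\<lambda>i. measure_pmf (S i)) J (Pi\<^sub>E J A)"
    let ?J = "J - {i, k}"
    let ?Y = "prod_emb (-{i, k}) (\<lambda>i. measure_pmf (S i)) ?J (Pi\<^sub>E ?J A)"
    let ?a = "\<lambda>l. if l \<in> J then A l else UNIV"
    have X: "?X = {\<eta>. \<forall>l\<in>J. \<eta> l \<in> A l}"
      by (auto simp: prod_emb_def PiE_iff)
    have Y: "?Y = {\<eta> \<in> space (rest_law S i k). \<forall>l\<in>?J. \<eta> l \<in> A l}"
      by (auto simp: prod_emb_def PiE_iff rest_law_def space_PiM extensional_def)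
    have Xs: "?X \<in> sets (field_law S)"
      unfolding field_law_def using J by (intro sets_PiM_I) auto
    have Ys: "?Y \<in> sets (rest_law S i k)"
      unfolding rest_law_def using J by (intro sets_PiM_I) auto
    have pre: "?T -` ?X \<inter> space ?PM = (?a i \<times> ?a k) \<times> ?Y"
    proof -
      have *: "(\<forall>l\<in>J. (\<eta>(i := x, k := y)) l \<in> A l) \<longleftrightarrow> x \<in> ?a i \<and> y \<in> ?a k \<and> (\<forall>l\<in>?J. \<eta> l \<in> A l)"
        for x y \<eta>
        using assms by (smt (verit) DiffE DiffI UNIV_I fun_upd_apply insertCI insertE singletonD)
      show ?thesis unfolding X Y
      proof (rule set_eqI)
        fix z :: "(site \<times> site) \<times> (int \<Rightarrow> site)"
        obtain x y \<eta> where z: "z = ((x, y), \<eta>)" by (metis surj_pair)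
        show "z \<in> ?T -` {\<eta>. \<forall>l\<in>J. \<eta> l \<in> A l} \<inter> space ?PM \<longleftrightarrow>
          z \<in> (?a i \<times> ?a k) \<times> {\<eta> \<in> space (rest_law S i k). \<forall>l\<in>?J. \<eta> l \<in> A l}"
          unfolding z using *[of \<eta> x y] by (simp add: space_pair_measure del: fun_upd_apply) blast
      qed
    qed
    have "emeasure (distr ?PM (field_law S) ?T) ?X = emeasure ?PM ((?a i \<times> ?a k) \<times> ?Y)"
      using Xs T by (simp add: emeasure_distr pre)
    also have "\<dots> = emeasure (pair_pmf (S i) (S k)) (?a i \<times> ?a k) * emeasure (rest_law S i k) ?Y"
      using Ys by (intro rest.emeasure_pair_measure_Times) auto
    also have "emeasure (pair_pmf (S i) (S k)) (?a i \<times> ?a k)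
        = emeasure (S i) (?a i) * emeasure (S k) (?a k)"
      unfolding measure_pair_pmf[symmetric]
      by (intro measure_pmf.emeasure_pair_measure_Times) auto
    also have "emeasure (rest_law S i k) ?Y = (\<Prod>l\<in>?J. emeasure (S l) (A l))"
      unfolding rest_law_def using J by (intro emeasure_PiM_emb) (auto simp: prob_space_measure_pmf)
    also have "emeasure (S i) (?a i) * emeasure (S k) (?a k) * \<dots> = (\<Prod>l\<in>J. emeasure (S l) (A l))"
    proof -
      have *: "(\<Prod>l\<in>J. emeasure (S l) (A l)) = (\<Prod>l\<in>insert i (insert k J). emeasure (S l) (?a l))"
        using J by (intro prod.mono_neutral_cong_left)
          (auto simp: measure_pmf.emeasure_space_1[simplified])
      have "insert i (insert k J) = insert i (insert k ?J)" by auto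
      also have "(\<Prod>l\<in>\<dots>. emeasure (S l) (?a l))
          = emeasure (S i) (?a i) * (emeasure (S k) (?a k) * (\<Prod>l\<in>?J. emeasure (S l) (?a l)))"
        using J assms by (subst prod.insert; simp)+
      also have "(\<Prod>l\<in>?J. emeasure (S l) (?a l)) = (\<Prod>l\<in>?J. emeasure (S l) (A l))"
        by (intro prod.cong) auto
      finally show ?thesis unfolding * by (simp add: mult.assoc)
    qed
    also have "\<dots> = emeasure (\<Pi>\<^sub>M i\<in>UNIV. measure_pmf (S i)) ?X"
      using J by (intro emeasure_PiM_emb[symmetric]) (auto simp: prob_space_measure_pmf)
    finally show "emeasure (\<Pi>\<^sub>M i\<in>UNIV. measure_pmf (S i)) ?X
        = emeasure (distr ?PM (field_law S) ?T) ?X" by (rule sym)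
  qed (simp add: field_law_def)
  thus ?thesis by (simp add: field_law_def)
qed

definition determined_by :: "int set \<Rightarrow> ((int \<Rightarrow> 'a) \<Rightarrow> 'b) \<Rightarrow> bool" where
  "determined_by A \<psi> \<longleftrightarrow> (\<forall>\<eta> \<eta>'. (\<forall>i\<in>A. \<eta> i = \<eta>' i) \<longrightarrow> \<psi> \<eta> = \<psi> \<eta>')"

text \<open>
  A function of finitely many sites factors through a
  countable discrete space.
\<close>

lemma determined_by_measurable:
  fixes \<psi> :: "(int \<Rightarrow> site) \<Rightarrow> real"
  assumes "finite A" "determined_by A \<psi>"
  shows "\<psi> \<in> borel_measurable (field_law S)"
proof -
  have eq: "\<psi> = (\<lambda>\<eta>. \<psi> (restrict \<eta> A))"
    using assms(2) by (auto simp: determined_by_def)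
  have "sets (PiM A (\<lambda>i. measure_pmf (S i))) = sets (PiM A (\<lambda>i. count_space (UNIV :: site set)))"
    by (intro sets_PiM_cong) auto
  also have "\<dots> = sets (count_space (PiE A (\<lambda>_. UNIV :: site set)))"
    using count_space_PiM_finite[OF assms(1), of "\<lambda>_. UNIV :: site set"] by simp
  finally have s: "sets (PiM A (\<lambda>i. measure_pmf (S i)))
      = sets (count_space (PiE A (\<lambda>_. UNIV :: site set)))" .
  have "\<psi> \<in> borel_measurable (PiM A (\<lambda>i. measure_pmf (S i)))"
    by (simp add: measurable_cong_sets[OF s refl] space_PiM)
  moreover have *: "(\<lambda>\<eta>. restrict \<eta> A) \<in> field_law S \<rightarrow>\<^sub>M PiM A (\<lambda>i. measure_pmf (S i))"
    unfolding field_law_def by (rule measurable_restrict_subset) auto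
  ultimately show ?thesis
    using measurable_compose[OF *, of \<psi> borel] eq by simp
qed

lemma expectation_two_sites:
  fixes F :: "(int \<Rightarrow> site) \<Rightarrow> real"
  assumes "i \<noteq> k" "integrable (field_law S) F"
  shows "(\<integral>\<eta>. F \<eta> \<partial>field_law S)
      = (\<integral>\<eta>. (\<integral>(x, y). F (\<eta>(i := x, k := y)) \<partial>pair_pmf (S i) (S k)) \<partial>rest_law S i k)"
    and "integrable (rest_law S i k)
           (\<lambda>\<eta>. \<integral>(x, y). F (\<eta>(i := x, k := y)) \<partial>pair_pmf (S i) (S k))"
proof -
  let ?P = "measure_pmf (pair_pmf (S i) (S k))" and ?R = "rest_law S i k"
  let ?T = "\<lambda>((x, y), \<eta>). \<eta>(i := x, k := y)"
  interpret R: prob_space ?R by (rule prob_space_rest_law)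
  interpret PR: pair_sigma_finite ?P ?R by standard
  note T = two_site_measurable[of i k "S i" "S k" S]
  have F: "integrable (?P \<Otimes>\<^sub>M ?R) (\<lambda>z. F (?T z))"
    using assms(2) field_law_two_sites[OF assms(1), of S] integrable_distr[OF T] by metis
  have "(\<integral>\<eta>. F \<eta> \<partial>field_law S) = (\<integral>z. F (?T z) \<partial>(?P \<Otimes>\<^sub>M ?R))"
    using field_law_two_sites[OF assms(1), of S] integral_distr[OF T] assms(2)
    by (metis borel_measurable_integrable)
  also have "\<dots> = (\<integral>\<eta>. (\<integral>z. F (?T (z, \<eta>)) \<partial>?P) \<partial>?R)"
    using PR.integral_snd[of "\<lambda>z \<eta>. F (?T (z, \<eta>))"] F by (simp add: case_prod_beta')
  finally show "(\<integral>\<eta>. F \<eta> \<partial>field_law S)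
      = (\<integral>\<eta>. (\<integral>(x, y). F (\<eta>(i := x, k := y)) \<partial>?P) \<partial>?R)"
    by (simp add: case_prod_beta')
  show "integrable ?R (\<lambda>\<eta>. \<integral>(x, y). F (\<eta>(i := x, k := y)) \<partial>?P)"
    using PR.integrable_snd[of "\<lambda>z \<eta>. F (?T (z, \<eta>))"] F by (simp add: case_prod_beta')
qed

text \<open>
  The rates are unbounded, so integrability is reduced to that of a majorant which lives on the two
  sites of the bond.
\<close>

lemma integrable_two_sites:
  fixes F :: "(int \<Rightarrow> site) \<Rightarrow> real" and R :: "site \<times> site \<Rightarrow> real"
  assumes "i \<noteq> k" "F \<in> borel_measurable (field_law S)"
    and "integrable (pair_pmf (S i) (S k)) R" "\<And>\<eta>. \<bar>F \<eta>\<bar> \<le> R (\<eta> i, \<eta> k)"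
  shows "integrable (field_law S) F"
proof -
  let ?P = "measure_pmf (pair_pmf (S i) (S k))" and ?R = "rest_law S i k"
  let ?T = "\<lambda>((x, y), \<eta>). \<eta>(i := x, k := y)"
  interpret R: prob_space ?R by (rule prob_space_rest_law)
  note T = two_site_measurable[of i k "S i" "S k" S]
  have "integrable (distr (?P \<Otimes>\<^sub>M ?R) ?P fst) R"
    using assms(3) by (simp add: R.distr_pair_fst)
  hence R: "integrable (?P \<Otimes>\<^sub>M ?R) (\<lambda>z. R (fst z))"
    by (rule integrable_distr[OF measurable_fst])
  have "integrable (?P \<Otimes>\<^sub>M ?R) (\<lambda>z. F (?T z))"
  proof (rule Bochner_Integration.integrable_bound[OF R measurable_compose[OF T assms(2)]])
    show "AE z in ?P \<Otimes>\<^sub>M ?R. norm (F (?T z)) \<le> norm (R (fst z))"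
    proof (rule AE_I2)
      fix z :: "(site \<times> site) \<times> (int \<Rightarrow> site)"
      show "norm (F (?T z)) \<le> norm (R (fst z))"
        using assms(4)[of "?T z"] assms(1) by (auto simp: case_prod_beta)
    qed
  qed
  thus ?thesis
    by (subst field_law_two_sites[OF assms(1)])
       (simp add: integrable_distr_eq[OF T assms(2)])
qed

section \<open>The generator on a single bond\<close>

text \<open>
  The summand of the basic coupling for one bond, with the test function \<open>G\<close> read as a function of the
  states of the two end points. The letters \<open>a\<close>, \<open>c\<close> stand for the lower configuration and \<open>b\<close>, \<open>d\<close>
  for the upper one.
\<close>

definition bond_gen :: "rate \<Rightarrow> rate \<Rightarrow> (site \<times> site \<Rightarrow> real) \<Rightarrow> site \<times> site \<Rightarrow> real" where
  "bond_gen p q G = (\<lambda>((a, b), (c, d)).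
      p a d * (G ((a - 1, b - 1), (c + 1, d + 1)) - G ((a, b), (c, d)))
    + (p a c - p a d) * (G ((a - 1, b), (c + 1, d)) - G ((a, b), (c, d)))
    + (p b d - p a d) * (G ((a, b - 1), (c, d + 1)) - G ((a, b), (c, d)))
    + q b c * (G ((a + 1, b + 1), (c - 1, d - 1)) - G ((a, b), (c, d)))
    + (q b d - q b c) * (G ((a, b + 1), (c, d - 1)) - G ((a, b), (c, d)))
    + (q a c - q b c) * (G ((a + 1, b), (c - 1, d)) - G ((a, b), (c, d))))"

definition bond_rate :: "rate \<Rightarrow> rate \<Rightarrow> site \<times> site \<Rightarrow> real" where
  "bond_rate p q = (\<lambda>((a, b), (c, d)).
      \<bar>p a d\<bar> + \<bar>p a c - p a d\<bar> + \<bar>p b d - p a d\<bar>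
    + \<bar>q b c\<bar> + \<bar>q b d - q b c\<bar> + \<bar>q a c - q b c\<bar>)"

lemma bond_gen_bound:
  assumes "\<And>z. \<bar>G z\<bar> \<le> K"
  shows "\<bar>bond_gen p q G z\<bar> \<le> 2 * K * bond_rate p q z"
proof -
  obtain a b c d where z: "z = ((a, b), (c, d))" by (metis surj_pair)
  have *: "\<bar>r * (G u - G v)\<bar> \<le> 2 * K * \<bar>r\<bar>" for r u v
  proof -
    have "\<bar>G u - G v\<bar> \<le> 2 * K" using assms[of u] assms[of v] by linarith
    from mult_left_mono[OF this abs_ge_zero[of r]] show ?thesis
      by (simp add: abs_mult mult.commute)
  qed
  show ?thesis
    unfolding z bond_gen_def bond_rate_def prod.case distrib_left
    by (intro order_trans[OF abs_triangle_ineq] add_mono *)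
qed

definition bond_term ::
  "rate \<Rightarrow> rate \<Rightarrow> ((int \<Rightarrow> site) \<Rightarrow> real) \<Rightarrow> int \<Rightarrow> (int \<Rightarrow> site) \<Rightarrow> real" where
  "bond_term p q \<psi> i \<eta> = bond_gen p q (\<lambda>(x, y). \<psi> (\<eta>(i := x, i + 1 := y))) (\<eta> i, \<eta> (i + 1))"

lemma bond_term_update:
  "bond_term p q \<psi> i (\<eta>(i := x, i + 1 := y)) = bond_gen p q (\<lambda>(x, y). \<psi> (\<eta>(i := x, i + 1 := y))) (x, y)"
proof -
  have "(\<eta>(i := x, i + 1 := y))(i := x', i + 1 := y') = \<eta>(i := x', i + 1 := y')" for x' y'
    by auto
  thus ?thesis unfolding bond_term_def by simp
qed

lemma determined_by_bond_term:
  assumes "determined_by A \<psi>"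
  shows "determined_by (insert i (insert (i + 1) A)) (bond_term p q \<psi> i)"
  unfolding determined_by_def
proof (intro allI impI)
  fix \<eta> \<eta>' :: "int \<Rightarrow> site"
  assume *: "\<forall>l\<in>insert i (insert (i + 1) A). \<eta> l = \<eta>' l"
  have "\<psi> (\<eta>(i := x, i + 1 := y)) = \<psi> (\<eta>'(i := x, i + 1 := y))" for x y
    using assms * by (simp add: determined_by_def)
  thus "bond_term p q \<psi> i \<eta> = bond_term p q \<psi> i \<eta>'"
    using * by (simp add: bond_term_def)
qed

text \<open>
  The list encodes a signed combination of product laws on two sites, which is what the generator of
  a bond turns the product law \<open>A\<close>, \<open>B\<close> into. The identity is required for all bounded \<open>G\<close>
  because the other sites, which are frozen, enter as parameters of \<open>G\<close>.
\<close>

definition bond_law :: "rate \<Rightarrow> rate \<Rightarrow> site pmf \<Rightarrow> site pmf \<Rightarrow> (real \<times> site pmf \<times> site pmf) list \<Rightarrow> bool" where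
  "bond_law p q A B l \<longleftrightarrow> integrable (pair_pmf A B) (bond_rate p q) \<and>
     (\<forall>G. bounded (range G) \<longrightarrow> (\<integral>z. bond_gen p q G z \<partial>pair_pmf A B)
        = (\<Sum>(c, A', B')\<leftarrow>l. c * (\<integral>z. G z \<partial>pair_pmf A' B')))"

lemma integral_sum_list:
  fixes f :: "'a \<Rightarrow> 'b \<Rightarrow> real"
  assumes "\<And>t. t \<in> set l \<Longrightarrow> integrable M (f t)"
  shows "(\<integral>x. (\<Sum>t\<leftarrow>l. f t x) \<partial>M) = (\<Sum>t\<leftarrow>l. \<integral>x. f t x \<partial>M)"
proof -
  have "integrable M (\<lambda>x. \<Sum>t\<leftarrow>l. f t x)
      \<and> (\<integral>x. (\<Sum>t\<leftarrow>l. f t x) \<partial>M) = (\<Sum>t\<leftarrow>l. \<integral>x. f t x \<partial>M)"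
    using assms by (induction l) auto
  thus ?thesis ..
qed

lemma integrable_determined:
  fixes \<psi> :: "(int \<Rightarrow> site) \<Rightarrow> real"
  assumes "finite A" "determined_by A \<psi>" "bounded (range \<psi>)"
  shows "integrable (field_law S) \<psi>"
proof -
  interpret prob_space "field_law S" by (rule prob_space_field_law)
  from assms(3) obtain K where "\<And>\<eta>. \<bar>\<psi> \<eta>\<bar> \<le> K" by (auto simp: bounded_iff)
  thus ?thesis
    by (intro integrable_const_bound[of _ K] determined_by_measurable[OF assms(1,2)]) auto
qed

text \<open>
  A law on two sites lifts to the infinite product: it is applied for each configuration of the
  remaining sites, whose law does not see the change of the two marginals.
\<close>

lemma bond_law_field:
  assumes law: "bond_law p q (S i) (S (i + 1)) l"
    and \<psi>: "finite A" "determined_by A \<psi>" "bounded (range \<psi>)"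
  shows "integrable (field_law S) (bond_term p q \<psi> i)"
    and "(\<integral>\<eta>. bond_term p q \<psi> i \<eta> \<partial>field_law S)
      = (\<Sum>(c, A', B')\<leftarrow>l. c * (\<integral>\<eta>. \<psi> \<eta> \<partial>field_law (S(i := A', i + 1 := B'))))"
proof -
  let ?R = "rest_law S i (i + 1)"
  from \<psi>(3) obtain K where K: "\<And>\<eta>. \<bar>\<psi> \<eta>\<bar> \<le> K" by (auto simp: bounded_iff)
  have meas: "bond_term p q \<psi> i \<in> borel_measurable (field_law S)"
    using \<psi> by (intro determined_by_measurable[OF _ determined_by_bond_term]) auto
  show int: "integrable (field_law S) (bond_term p q \<psi> i)"
  proof (rule integrable_two_sites[OF _ meas])
    show "integrable (pair_pmf (S i) (S (i + 1))) (\<lambda>z. 2 * K * bond_rate p q z)"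
      using law by (simp add: bond_law_def)
    show "\<bar>bond_term p q \<psi> i \<eta>\<bar> \<le> 2 * K * bond_rate p q (\<eta> i, \<eta> (i + 1))" for \<eta>
      unfolding bond_term_def by (rule bond_gen_bound) (auto simp: K)
  qed simp
  let ?G = "\<lambda>\<eta> (x, y). \<psi> (\<eta>(i := x, i + 1 := y))"
  let ?S = "\<lambda>t. S(i := fst (snd t), i + 1 := snd (snd t))"
  have rest: "rest_law (?S t) i (i + 1) = ?R" for t
    unfolding rest_law_def by (intro PiM_cong) auto
  have G: "(\<integral>\<eta>. \<psi> \<eta> \<partial>field_law (?S t)) = (\<integral>\<eta>. (\<integral>z. ?G \<eta> z \<partial>pair_pmf (fst (snd t)) (snd (snd t))) \<partial>?R)"
    "integrable ?R (\<lambda>\<eta>. \<integral>z. ?G \<eta> z \<partial>pair_pmf (fst (snd t)) (snd (snd t)))" for t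
    using expectation_two_sites[OF _ integrable_determined[OF \<psi>], of i "i + 1" "?S t"] 
    unfolding rest by simp_all
  have bdd: "bounded (range (?G \<eta>))" for \<eta>
    using \<psi>(3) by (rule bounded_subset) auto
  have "(\<integral>\<eta>. bond_term p q \<psi> i \<eta> \<partial>field_law S)
      = (\<integral>\<eta>. (\<integral>z. bond_gen p q (?G \<eta>) z \<partial>pair_pmf (S i) (S (i + 1))) \<partial>?R)"
    by (subst expectation_two_sites(1)[OF _ int, of i "i + 1"], simp)
       (simp only: bond_term_update case_prod_beta' prod.collapse)
  also have "\<dots> = (\<integral>\<eta>. (\<Sum>t\<leftarrow>l. fst t * (\<integral>z. ?G \<eta> z \<partial>pair_pmf (fst (snd t)) (snd (snd t)))) \<partial>?R)"
    using law bdd unfolding bond_law_def by (simp add: case_prod_beta')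
  also have "\<dots> = (\<Sum>t\<leftarrow>l. \<integral>\<eta>. fst t * (\<integral>z. ?G \<eta> z \<partial>pair_pmf (fst (snd t)) (snd (snd t))) \<partial>?R)"
    by (intro integral_sum_list integrable_mult_right G(2))
  also have "\<dots> = (\<Sum>t\<leftarrow>l. fst t * (\<integral>\<eta>. \<psi> \<eta> \<partial>field_law (?S t)))"
    unfolding G(1) by simp
  finally show "(\<integral>\<eta>. bond_term p q \<psi> i \<eta> \<partial>field_law S)
      = (\<Sum>(c, A', B')\<leftarrow>l. c * (\<integral>\<eta>. \<psi> \<eta> \<partial>field_law (S(i := A', i + 1 := B'))))"
    by (simp add: case_prod_beta')
qed

lemma expectation_irrelevant_site:
  fixes \<psi> :: "(int \<Rightarrow> site) \<Rightarrow> real"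
  assumes "finite A" "determined_by A \<psi>" "bounded (range \<psi>)" "i \<notin> A"
  shows "(\<integral>\<eta>. \<psi> \<eta> \<partial>field_law (S(i := B))) = (\<integral>\<eta>. \<psi> \<eta> \<partial>field_law S)"
proof -
  have "\<psi> (\<eta>(i := x, i + 1 := y)) = \<psi> (\<eta>(i + 1 := y))" for \<eta> x y
    using assms(2,4) by (auto simp: determined_by_def)
  hence *: "(\<integral>\<eta>. \<psi> \<eta> \<partial>field_law S')
      = (\<integral>\<eta>. (\<integral>y. \<psi> (\<eta>(i + 1 := y)) \<partial>S' (i + 1)) \<partial>rest_law S' i (i + 1))" for S'
    by (subst expectation_two_sites(1)[OF _ integrable_determined[OF assms(1-3)], of i "i + 1"])
       (simp_all add: case_prod_beta'
         expectation_pair_pmf_snd[where f = "\<lambda>y. \<psi> (\<eta>(i + 1 := y))" for \<eta>])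
  have "rest_law (S(i := B)) i (i + 1) = rest_law S i (i + 1)"
    unfolding rest_law_def by (intro PiM_cong) auto
  thus ?thesis by (simp add: *)
qed

definition unzip :: "(int \<Rightarrow> site) \<Rightarrow> config \<times> config" where
  "unzip \<eta> = (fst \<circ> \<eta>, snd \<circ> \<eta>)"

text \<open>
  The window is taken large enough to contain the shock and both bonds next to it. Bonds outside
  \<open>{m..<n}\<close> do not touch it, and its end points \<open>m\<close> and \<open>n\<close> are not seen by the test function.
\<close>

lemma finite_cylinder_window:
  assumes "finite_cylinder \<phi>"
  obtains m n where "m < j - 1" "j + 1 < n" "determined_by {m<..<n} (\<phi> \<circ> unzip)"
proof -
  from assms obtain A where A: "finite A" and \<phi>: "\<And>\<omega> \<zeta> \<omega>' \<zeta>'.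
      (\<forall>i\<in>A. \<omega> i = \<omega>' i \<and> \<zeta> i = \<zeta>' i) \<Longrightarrow> \<phi> (\<omega>, \<zeta>) = \<phi> (\<omega>', \<zeta>')"
    unfolding finite_cylinder_def by blast
  let ?A = "insert j A"
  define m n where "m = Min ?A - 2" and "n = Max ?A + 2"
  have "Min ?A \<le> i \<and> i \<le> Max ?A" if "i \<in> ?A" for i
    using A that by (intro conjI Min_le Max_ge) auto
  hence *: "m < i - 1 \<and> i + 1 < n" if "i \<in> ?A" for i
    using that by (fastforce simp: m_def n_def)
  have "determined_by {m<..<n} (\<phi> \<circ> unzip)"
    unfolding determined_by_def
  proof (intro allI impI)
    fix \<eta> \<eta>' :: "int \<Rightarrow> site"
    assume eq: "\<forall>i\<in>{m<..<n}. \<eta> i = \<eta>' i"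
    have "\<eta> i = \<eta>' i" if "i \<in> A" for i
      using eq *[of i] that by simp
    thus "(\<phi> \<circ> unzip) \<eta> = (\<phi> \<circ> unzip) \<eta>'"
      by (auto simp: unzip_def intro!: \<phi>)
  qed
  thus ?thesis using that * by blast
qed

lemma coupled_gen_unzip:
  assumes "determined_by {m<..<n} (\<phi> \<circ> unzip)"
  shows "coupled_gen p q \<phi> (unzip \<eta>) = (\<Sum>i\<in>{m..<n}. bond_term p q (\<phi> \<circ> unzip) i \<eta>)"
proof -
  have upd: "fst \<circ> (\<eta>(i := (a, b), k := (c, d))) = (fst \<circ> \<eta>)(i := a, k := c)"
    "snd \<circ> (\<eta>(i := (a, b), k := (c, d))) = (snd \<circ> \<eta>)(i := b, k := d)" for i k a b c d
    by auto
  have same: "(fst \<circ> \<eta>)(i := fst (\<eta> i), k := fst (\<eta> k)) = fst \<circ> \<eta>"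
    "(snd \<circ> \<eta>)(i := snd (\<eta> i), k := snd (\<eta> k)) = snd \<circ> \<eta>" for i k
    by auto
  have jump: "jump \<omega> i (i + 1) = \<omega> (i := \<omega> i - 1, i + 1 := \<omega> (i + 1) + 1)"
    "jump \<omega> (i + 1) i = \<omega> (i := \<omega> i + 1, i + 1 := \<omega> (i + 1) - 1)" for \<omega> i
    by (auto simp: jump_def)
  have "coupled_gen p q \<phi> (unzip \<eta>) = (\<Sum>\<^sub>\<infinity>i\<in>UNIV. bond_term p q (\<phi> \<circ> unzip) i \<eta>)"
    unfolding coupled_gen_def bond_term_def bond_gen_def unzip_def case_prod_beta'
    by (simp add: upd same jump del: fun_upd_apply)
  also have "\<dots> = (\<Sum>\<^sub>\<infinity>i\<in>{m..<n}. bond_term p q (\<phi> \<circ> unzip) i \<eta>)"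
  proof (rule infsum_cong_neutral)
    fix i assume "i \<in> UNIV - {m..<n}"
    hence "(\<phi> \<circ> unzip) (\<eta>(i := x, i + 1 := y)) = (\<phi> \<circ> unzip) \<eta>" for x y
      using assms unfolding determined_by_def by (smt (verit) DiffD2 atLeastLessThan_iff fun_upd_apply greaterThanLessThan_iff)
    thus "bond_term p q (\<phi> \<circ> unzip) i \<eta> = 0"
      unfolding bond_term_def bond_gen_def by (simp add: case_prod_beta')
  qed auto
  also have "\<dots> = (\<Sum>i\<in>{m..<n}. bond_term p q (\<phi> \<circ> unzip) i \<eta>)"
    by simp
  finally show ?thesis .
qed

lemma measurable_zip:
  "(\<lambda>(\<omega>, \<zeta>) i. (\<omega> i, \<zeta> i)) \<in> pair_space \<rightarrow>\<^sub>M field_law S"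
proof -
  have c: "(\<lambda>\<omega>. \<omega> l) \<in> config_space \<rightarrow>\<^sub>M count_space UNIV" for l :: int
    unfolding config_space_def by (rule measurable_component_singleton) simp
  have "(\<lambda>z. (fst z l, snd z l)) \<in> pair_space \<rightarrow>\<^sub>M count_space (UNIV :: int set) \<Otimes>\<^sub>M count_space (UNIV :: int set)" for l
    unfolding pair_space_def
    by (intro measurable_Pair measurable_compose[OF measurable_fst c] measurable_compose[OF measurable_snd c])
  hence "(\<lambda>z. (fst z l, snd z l)) \<in> pair_space \<rightarrow>\<^sub>M measure_pmf (S l)" for l
    by (simp add: pair_measure_countable cong: measurable_cong_sets)
  thus ?thesis unfolding field_law_def case_prod_beta
    by (intro measurable_PiM_single') (auto simp: space_PiM)
qed

text \<open>
  Functions of pairs of configurations are studied as functions of configurations of pairs, and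
  measurability is transported back along the inverse of \<open>unzip\<close>.
\<close>

lemma measurable_of_unzip:
  assumes "f \<circ> unzip \<in> borel_measurable (field_law S)"
  shows "f \<in> borel_measurable pair_space"
proof -
  have "f = (\<lambda>z. (f \<circ> unzip) ((\<lambda>(\<omega>, \<zeta>) i. (\<omega> i, \<zeta> i)) z))"
    by (auto simp: unzip_def o_def)
  thus ?thesis using measurable_compose[OF measurable_zip assms] by simp
qed

section \<open>Telescoping the bond contributions\<close>

definition diag :: "int pmf \<Rightarrow> site pmf" where
  "diag \<mu> = map_pmf (\<lambda>x. (x, x)) \<mu>"

definition discrepancy :: "int pmf \<Rightarrow> site pmf" where
  "discrepancy \<mu> = map_pmf (\<lambda>x. (x, x + 1)) \<mu>"

definition shock :: "site pmf \<Rightarrow> site pmf \<Rightarrow> site pmf \<Rightarrow> int \<Rightarrow> int \<Rightarrow> site pmf" where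
  "shock L R C j i = (if i < j then L else if i = j then C else R)"

lemma shock_measure_eq:
  "shock_measure left right hat j
     = distr (field_law (shock (diag left) (diag right) (discrepancy hat) j)) pair_space unzip"
  unfolding shock_measure_def field_law_def
  by (intro arg_cong3[where f = distr] PiM_cong)
     (auto simp: shock_def shock_site_def diag_def discrepancy_def unzip_def)

lemma measurable_unzip:
  "unzip \<in> field_law (shock (diag left) (diag right) (discrepancy hat) j) \<rightarrow>\<^sub>M pair_space"
proof -
  have "shock_site left right hat j = shock (diag left) (diag right) (discrepancy hat) j"
    by (auto simp: shock_site_def shock_def diag_def discrepancy_def)
  thus ?thesis using unzip_measurable[of left right hat j]
    by (simp add: unzip_def[abs_def] field_law_def)
qed

lemma sum_telescope_int:
  fixes f :: "int \<Rightarrow> real"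
  assumes "m \<le> n"
  shows "(\<Sum>i\<in>{m..<n}. f (i + 1) - f i) = f n - f m"
  using assms
proof (induction n rule: int_ge_induct)
  case (step n)
  have "{m..<n + 1} = insert n {m..<n}" using step by auto
  thus ?case using step by simp
qed simp

text \<open>
  The telescoping argument. The marginals \<open>L'\<close> and \<open>R'\<close> are the tilted marginals of the two
  phases, with constants \<open>a\<close> and \<open>b\<close>. The law \<open>C'\<close> with weight \<open>w\<close> is the tilted marginal at the
  second class particle: it appears at both adjacent bonds with opposite signs and cancels. Exchanging
  the discrepancy with the neighbouring phase, that is replacing \<open>(L, C)\<close> by \<open>(C, R)\<close> or \<open>(C, R)\<close> by
  \<open>(L, C)\<close>, turns the shock at \<open>j\<close> into the shock at \<open>j - 1\<close> or \<open>j + 1\<close>. The constants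
  \<open>u\<close> and \<open>v\<close> are the parts of the loss at the two bonds that are proportional to the shock law itself;
  they are nonzero for exclusion only.
\<close>

lemma shock_evolution:
  assumes LL: "bond_law p q (diag left) (diag left) [(a, diag left, L'), (- a, L', diag left)]"
    and RR: "bond_law p q (diag right) (diag right) [(b, diag right, R'), (- b, R', diag right)]"
    and LC: "bond_law p q (diag left) (discrepancy hat)
      [(Q, discrepancy hat, diag right), (- a, L', discrepancy hat),
       (w, diag left, C'), (- u, diag left, discrepancy hat)]"
    and CR: "bond_law p q (discrepancy hat) (diag right)
      [(P, diag left, discrepancy hat), (b, discrepancy hat, R'),
       (- w, C', diag right), (- v, discrepancy hat, diag right)]"
    and \<phi>: "test_function \<phi>"
  defines "\<nu> \<equiv> shock_measure left right hat"
  shows "integrable (\<nu> j) (coupled_gen p q \<phi>)"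
    and "(\<integral>z. coupled_gen p q \<phi> z \<partial>\<nu> j)
       = P * ((\<integral>z. \<phi> z \<partial>\<nu> (j + 1)) - (\<integral>z. \<phi> z \<partial>\<nu> j))
       + Q * ((\<integral>z. \<phi> z \<partial>\<nu> (j - 1)) - (\<integral>z. \<phi> z \<partial>\<nu> j))"
proof -
  (* A constant test function is annihilated by the generator, so the weights of each law sum to 0. *)
  have "Q - a + w - u = 0"
    using LC unfolding bond_law_def by (auto simp: bond_gen_def case_prod_beta' dest!: spec[of _ "\<lambda>_. 1"])
  moreover have "P + b - w - v = 0"
    using CR unfolding bond_law_def by (auto simp: bond_gen_def case_prod_beta' dest!: spec[of _ "\<lambda>_. 1"])
  ultimately have balance: "P + Q = a - b + u + v" by simp
  define L R C where "L = diag left" and "R = diag right" and "C = discrepancy hat"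
  note LL = LL[folded L_def] and RR = RR[folded R_def]
  note LC = LC[folded L_def R_def C_def] and CR = CR[folded L_def R_def C_def]
  define \<psi> where "\<psi> = \<phi> \<circ> unzip"
  define S where "S = shock L R C"
  define E where "E T = (\<integral>\<eta>. \<psi> \<eta> \<partial>field_law T)" for T
  from \<phi> have "finite_cylinder \<phi>" by (simp add: test_function_def)
  then obtain m n where mn: "m < j - 1" "j + 1 < n" and det': "determined_by {m<..<n} (\<phi> \<circ> unzip)"
    by (rule finite_cylinder_window)
  have bdd: "bounded (range \<psi>)"
    using \<phi> unfolding test_function_def \<psi>_def by (elim conjE bounded_subset) auto
  note det = det'[folded \<psi>_def]
  note gen = coupled_gen_unzip[OF det', folded \<psi>_def]
  have \<nu>: "\<nu> k = distr (field_law (S k)) pair_space unzip" for k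
    unfolding \<nu>_def S_def L_def R_def C_def by (rule shock_measure_eq)
  have unzip: "unzip \<in> field_law (S k) \<rightarrow>\<^sub>M pair_space" for k
    unfolding S_def L_def R_def C_def by (rule measurable_unzip)
  have "\<phi> \<in> borel_measurable pair_space"
    using determined_by_measurable[OF _ det] by (intro measurable_of_unzip) (auto simp: \<psi>_def)
  hence E\<nu>: "(\<integral>z. \<phi> z \<partial>\<nu> k) = E (S k)" for k
    unfolding \<nu> E_def by (simp add: integral_distr[OF unzip] \<psi>_def o_def)
  define B where "B i = (\<integral>\<eta>. bond_term p q \<psi> i \<eta> \<partial>field_law (S j))" for i
  define T where "T i = E ((S j)(i := L'))" for i
  define T' where "T' i = E ((S j)(i := R'))" for i

  have bond: "integrable (field_law (S j)) (bond_term p q \<psi> i) \<and>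
      B i = (\<Sum>(c, A', B')\<leftarrow>l. c * E ((S j)(i := A', i + 1 := B')))"
    if "bond_law p q (S j i) (S j (i + 1)) l" for i l
    using bond_law_field[of p q "S j" i l, OF that _ det bdd] by (simp add: B_def E_def)

  have far_left: "integrable (field_law (S j)) (bond_term p q \<psi> i) \<and> B i = a * T (i + 1) - a * T i"
    if "i < j - 1" for i
  proof -
    have "S j i = L" "S j (i + 1) = L" using that by (auto simp: S_def shock_def)
    moreover from this have "(S j)(i := L, i + 1 := L') = (S j)(i + 1 := L')"
      "(S j)(i := L', i + 1 := L) = (S j)(i := L')" by (auto simp: fun_eq_iff)
    ultimately show ?thesis using bond[of i] LL by (simp add: T_def)
  qed
  have far_right: "integrable (field_law (S j)) (bond_term p q \<psi> i) \<and> B i = b * T' (i + 1) - b * T' i"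
    if "j < i" for i
  proof -
    have "S j i = R" "S j (i + 1) = R" using that by (auto simp: S_def shock_def)
    moreover from this have "(S j)(i := R, i + 1 := R') = (S j)(i + 1 := R')"
      "(S j)(i := R', i + 1 := R) = (S j)(i := R')" by (auto simp: fun_eq_iff)
    ultimately show ?thesis using bond[of i] RR by (simp add: T'_def)
  qed
  have near_left: "integrable (field_law (S j)) (bond_term p q \<psi> (j - 1)) \<and>
      B (j - 1) = Q * E (S (j - 1)) - a * T (j - 1) + w * E ((S j)(j := C')) - u * E (S j)"
  proof -
    have "S j (j - 1) = L" "S j j = C" by (auto simp: S_def shock_def)
    moreover have "(S j)(j - 1 := C, j := R) = S (j - 1)" "(S j)(j - 1 := L, j := C) = S j"
      "(S j)(j - 1 := L', j := C) = (S j)(j - 1 := L')"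
      "(S j)(j - 1 := L, j := C') = (S j)(j := C')" by (auto simp: S_def shock_def fun_eq_iff)
    ultimately show ?thesis using bond[of "j - 1"] LC by (simp add: T_def)
  qed
  have near_right: "integrable (field_law (S j)) (bond_term p q \<psi> j) \<and>
      B j = P * E (S (j + 1)) + b * T' (j + 1) - w * E ((S j)(j := C')) - v * E (S j)"
  proof -
    have "S j j = C" "S j (j + 1) = R" by (auto simp: S_def shock_def)
    moreover have "(S j)(j := L, j + 1 := C) = S (j + 1)" "(S j)(j := C, j + 1 := R) = S j"
      "(S j)(j := C, j + 1 := R') = (S j)(j + 1 := R')"
      "(S j)(j := C', j + 1 := R) = (S j)(j := C')" by (auto simp: S_def shock_def fun_eq_iff)
    ultimately show ?thesis using bond[of j] CR by (simp add: T'_def)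
  qed
  \<comment> \<open>every bond is of one of the four kinds\<close>
  have int: "integrable (field_law (S j)) (bond_term p q \<psi> i)" for i
    using far_left[of i] far_right[of i] near_left near_right
    by (cases "i < j - 1"; cases "i = j - 1"; cases "i = j"; cases "j < i") auto

  have meas: "coupled_gen p q \<phi> \<in> borel_measurable pair_space"
    by (rule measurable_of_unzip[of _ "S j"]) (use int in \<open>auto simp: gen o_def\<close>)
  have "integrable (field_law (S j)) (\<lambda>\<eta>. coupled_gen p q \<phi> (unzip \<eta>))"
    unfolding gen by (intro Bochner_Integration.integrable_sum int)
  thus "integrable (\<nu> j) (coupled_gen p q \<phi>)"
    unfolding \<nu> by (simp add: integrable_distr_eq[OF unzip meas])

  have "(\<integral>z. coupled_gen p q \<phi> z \<partial>\<nu> j) = (\<Sum>i\<in>{m..<n}. B i)"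
    unfolding \<nu> by (simp add: integral_distr[OF unzip meas] gen Bochner_Integration.integral_sum int B_def)
  also have "{m..<n} = {m..<j - 1} \<union> ({j - 1, j} \<union> {j + 1..<n})"
    using mn by auto
  also have "(\<Sum>i\<in>\<dots>. B i) = (\<Sum>i\<in>{m..<j - 1}. B i) + (B (j - 1) + B j + (\<Sum>i\<in>{j + 1..<n}. B i))"
    by (subst sum.union_disjoint; simp)+
  also have "(\<Sum>i\<in>{m..<j - 1}. B i) = (\<Sum>i\<in>{m..<j - 1}. a * T (i + 1) - a * T i)"
    using far_left by (intro sum.cong) auto
  also have "\<dots> = a * T (j - 1) - a * T m"
    using mn by (intro sum_telescope_int) auto
  also have "(\<Sum>i\<in>{j + 1..<n}. B i) = (\<Sum>i\<in>{j + 1..<n}. b * T' (i + 1) - b * T' i)"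
    using far_right by (intro sum.cong) auto
  also have "\<dots> = b * T' n - b * T' (j + 1)"
    using mn by (intro sum_telescope_int) auto
  also have "T m = E (S j)"
    unfolding T_def E_def by (rule expectation_irrelevant_site[OF _ det bdd]) auto
  also have "T' n = E (S j)"
    unfolding T'_def E_def by (rule expectation_irrelevant_site[OF _ det bdd]) auto
  also have "a * T (j - 1) - a * E (S j) + (B (j - 1) + B j + (b * E (S j) - b * T' (j + 1)))
      = P * E (S (j + 1)) + Q * E (S (j - 1)) - (a - b + u + v) * E (S j)"
    using near_left near_right by (simp add: algebra_simps)
  finally show "(\<integral>z. coupled_gen p q \<phi> z \<partial>\<nu> j)
       = P * ((\<integral>z. \<phi> z \<partial>\<nu> (j + 1)) - (\<integral>z. \<phi> z \<partial>\<nu> j))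
       + Q * ((\<integral>z. \<phi> z \<partial>\<nu> (j - 1)) - (\<integral>z. \<phi> z \<partial>\<nu> j))"
    unfolding balance[symmetric] E\<nu> by (simp add: algebra_simps)
qed

lemma shock_identityI:
  assumes "\<And>j \<phi>. test_function \<phi> \<Longrightarrow> integrable (\<nu> j) (coupled_gen p q \<phi>)"
    and "\<And>j \<phi>. test_function \<phi> \<Longrightarrow> (\<integral>z. coupled_gen p q \<phi> z \<partial>\<nu> j)
       = P * ((\<integral>z. \<phi> z \<partial>\<nu> (j + 1)) - (\<integral>z. \<phi> z \<partial>\<nu> j))
       + Q * ((\<integral>z. \<phi> z \<partial>\<nu> (j - 1)) - (\<integral>z. \<phi> z \<partial>\<nu> j))"
  shows "shock_identity p q \<nu> P Q"
  unfolding shock_identity_def Let_def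
proof (intro allI impI conjI)
  fix j \<phi> K assume \<phi>: "test_function \<phi>" and "coupled_dynamics p q (range \<nu>) K"
  hence "((\<lambda>t. \<integral>x. \<phi> x \<partial>(\<nu> j \<bind> K t)) has_real_derivative (\<integral>x. coupled_gen p q \<phi> x \<partial>\<nu> j))
          (at 0 within {0..})"
    unfolding coupled_dynamics_def by blast
  thus "((\<lambda>t. \<integral>x. \<phi> x \<partial>(\<nu> j \<bind> K t)) has_real_derivative
        P * ((\<integral>z. \<phi> z \<partial>\<nu> (j + 1)) - (\<integral>z. \<phi> z \<partial>\<nu> j))
       + Q * ((\<integral>z. \<phi> z \<partial>\<nu> (j - 1)) - (\<integral>z. \<phi> z \<partial>\<nu> j))) (at 0 within {0..})"
    by (simp only: assms(2)[OF \<phi>])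
qed (use assms in blast)+

lemma coupled_gen_add:
  assumes "finite_cylinder \<phi>"
  shows "coupled_gen (\<lambda>y z. p y z + p' y z) no_rate \<phi> x
       = coupled_gen p no_rate \<phi> x + coupled_gen p' no_rate \<phi> x"
proof -
  obtain m n where det: "determined_by {m<..<n} (\<phi> \<circ> unzip)"
    using finite_cylinder_window[OF assms] by blast
  have x: "x = unzip (\<lambda>i. (fst x i, snd x i))" by (simp add: unzip_def o_def)
  show ?thesis
    by (subst (1 2 3) x)
      (auto simp: coupled_gen_unzip[OF det] sum.distrib[symmetric] bond_term_def bond_gen_def
        no_rate_def algebra_simps intro!: sum.cong)
qed

section \<open>Change of measure on two sites\<close>

text \<open>
  A change of measure stated between mass functions, so that it passes to the integral of every
  function, integrable or not.
\<close>

definition tilts :: "('a \<Rightarrow> real) \<Rightarrow> 'a pmf \<Rightarrow> real \<Rightarrow> 'a pmf \<Rightarrow> bool" where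
  "tilts r A c A' \<longleftrightarrow> (\<forall>x. r x * pmf A x = c * pmf A' x)"

lemma tilts_expectation:
  assumes "tilts r A c A'"
  shows "(\<integral>x. r x * F x \<partial>measure_pmf A) = c * (\<integral>x. F x \<partial>measure_pmf A')"
proof -
  have "(\<integral>x. r x * F x \<partial>measure_pmf A) = (\<integral>x. (r x * pmf A x) * F x \<partial>count_space UNIV)"
    unfolding measure_pmf_eq_density by (subst integral_density) (simp_all add: mult_ac)
  also have "\<dots> = (\<integral>x. c * (pmf A' x * F x) \<partial>count_space UNIV)"
    using assms by (simp add: tilts_def mult.assoc)
  also have "\<dots> = c * (\<integral>x. F x \<partial>measure_pmf A')"
    unfolding measure_pmf_eq_density by (subst integral_density) simp_all
  finally show ?thesis .
qed

lemma tilts_integrable: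
  fixes F :: "'a \<Rightarrow> real"
  assumes "tilts r A c A'" "bounded (range F)"
  shows "integrable (measure_pmf A) (\<lambda>x. r x * F x)"
proof -
  obtain K where "\<And>x. \<bar>F x\<bar> \<le> K" using assms(2) by (auto simp: bounded_iff)
  hence "integrable (measure_pmf A') F"
    by (intro measure_pmf.integrable_const_bound[where B = K]) auto
  hence "integrable (count_space UNIV) (\<lambda>x. c * (pmf A' x * F x))"
    unfolding measure_pmf_eq_density by (subst (asm) integrable_density) simp_all
  also have "(\<lambda>x. c * (pmf A' x * F x)) = (\<lambda>x. pmf A x *\<^sub>R (r x * F x))"
    using assms(1) by (auto simp: tilts_def fun_eq_iff mult_ac)
  finally show ?thesis
    unfolding measure_pmf_eq_density by (subst integrable_density) simp_all
qed

lemma tilts_diff: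
  assumes "tilts r A c A'" "tilts r' A c' A'"
  shows "tilts (\<lambda>x. r x - r' x) A (c - c') A'"
  using assms by (simp add: tilts_def left_diff_distrib)

lemma tilts_pair_fst:
  assumes "tilts r A c A'"
  shows "tilts (\<lambda>z. r (fst z)) (pair_pmf A B) c (pair_pmf A' B)"
  using assms by (simp add: tilts_def pmf_pair split: prod.split flip: mult.assoc) 

lemma tilts_pair_snd:
  assumes "tilts r B c B'"
  shows "tilts (\<lambda>z. r (snd z)) (pair_pmf A B) c (pair_pmf A B')"
  unfolding tilts_def
proof
  fix z :: "'b \<times> 'a"
  show "r (snd z) * pmf (pair_pmf A B) z = c * pmf (pair_pmf A B') z"
    using assms[unfolded tilts_def, rule_format, of "snd z"]
    by (cases z) (simp add: pmf_pair mult.left_commute)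
qed

lemma tilts_map:
  assumes "inj h" "\<And>x. r (h x) * pmf A x = c * pmf A' x"
  shows "tilts r (map_pmf h A) c (map_pmf h A')"
  unfolding tilts_def
proof
  fix y show "r y * pmf (map_pmf h A) y = c * pmf (map_pmf h A') y"
  proof (cases "y \<in> range h")
    case True
    then show ?thesis using assms by (auto simp: pmf_map_inj')
  next
    case False
    then have "pmf (map_pmf h M) y = 0" for M
      by (intro pmf_map_outside) auto
    then show ?thesis by simp
  qed
qed

lemma expectation_pair_map:
  fixes G :: "'c \<times> 'd \<Rightarrow> real"
  shows "(\<integral>z. G (h (fst z), k (snd z)) \<partial>pair_pmf A B)
       = (\<integral>z. G z \<partial>pair_pmf (map_pmf h A) (map_pmf k B))"
  unfolding map_pair[symmetric] by (simp add: case_prod_beta')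

text \<open>
  The contribution of one kind of jump: the rate is absorbed in the law, and the jump, which
  acts on the two sites by \<open>h\<close> and \<open>k\<close>, transports the tilted laws.
\<close>

lemma tilts_exchange:
  fixes G :: "site \<times> site \<Rightarrow> real"
  assumes tilt: "tilts r (pair_pmf A B) c (pair_pmf A' B')" and G: "bounded (range G)"
  shows "integrable (pair_pmf A B) (\<lambda>z. r z * (G (h (fst z), k (snd z)) - G z))"
    and "(\<integral>z. r z * (G (h (fst z), k (snd z)) - G z) \<partial>pair_pmf A B)
      = c * (\<integral>z. G z \<partial>pair_pmf (map_pmf h A') (map_pmf k B')) - c * (\<integral>z. G z \<partial>pair_pmf A' B')"
proof -
  have b: "bounded (range (\<lambda>z. G (h (fst z), k (snd z))))"
    using G by (rule bounded_subset) auto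
  have int: "integrable (pair_pmf A B) (\<lambda>z. r z * G (h (fst z), k (snd z)))"
    "integrable (pair_pmf A B) (\<lambda>z. r z * G z)"
    using tilts_integrable[OF tilt] b G by blast+
  thus "integrable (pair_pmf A B) (\<lambda>z. r z * (G (h (fst z), k (snd z)) - G z))"
    by (simp add: right_diff_distrib)
  show "(\<integral>z. r z * (G (h (fst z), k (snd z)) - G z) \<partial>pair_pmf A B)
      = c * (\<integral>z. G z \<partial>pair_pmf (map_pmf h A') (map_pmf k B')) - c * (\<integral>z. G z \<partial>pair_pmf A' B')"
    using int by (simp add: right_diff_distrib tilts_expectation[OF tilt] expectation_pair_map)
qed

text \<open>
  When the rate depends on the source site only, both configurations jump together at the rate of the
  lower one, which is the smaller when the rate increases, and the upper configuration jumps alone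
  with the excess. The first two hypotheses on images say that a joint jump undoes the tilt at the
  source and creates it at the target; \<open>A2\<close> and \<open>B2\<close> are the laws after a jump of the upper
  configuration alone.
\<close>

lemma bond_law_source_rate:
  assumes lower: "tilts (\<lambda>x. g (fst x)) A c A'" and upper: "tilts (\<lambda>x. g (snd x)) A c' A'"
    and "map_pmf (\<lambda>(x, y). (x - 1, y - 1)) A' = A" "map_pmf (\<lambda>(x, y). (x + 1, y + 1)) B = B'"
    and "map_pmf (\<lambda>(x, y). (x, y - 1)) A' = A2" "map_pmf (\<lambda>(x, y). (x, y + 1)) B = B2"
  shows "bond_law (\<lambda>y z. g y) no_rate A B [(c, A, B'), (- c', A', B), (c' - c, A2, B2)]"
  unfolding bond_law_def
proof (intro conjI allI impI)
  note t = tilts_pair_fst[OF lower, of B] and t' = tilts_pair_fst[OF upper, of B]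
  have "integrable (pair_pmf A B) (\<lambda>z. g (fst (fst z)))"
    "integrable (pair_pmf A B) (\<lambda>z. g (snd (fst z)))"
    using tilts_integrable[OF t, of "\<lambda>_. 1"] tilts_integrable[OF t', of "\<lambda>_. 1"] by auto
  thus "integrable (pair_pmf A B) (bond_rate (\<lambda>y z. g y) no_rate)"
    unfolding bond_rate_def no_rate_def by (simp add: case_prod_beta')
  fix G :: "site \<times> site \<Rightarrow> real" assume G: "bounded (range G)"
  have eq: "bond_gen (\<lambda>y z. g y) no_rate G
      = (\<lambda>z. g (fst (fst z)) * (G ((\<lambda>(x, y). (x - 1, y - 1)) (fst z), (\<lambda>(x, y). (x + 1, y + 1)) (snd z)) - G z)
      + (g (snd (fst z)) - g (fst (fst z)))
        * (G ((\<lambda>(x, y). (x, y - 1)) (fst z), (\<lambda>(x, y). (x, y + 1)) (snd z)) - G z))"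
    unfolding bond_gen_def no_rate_def by (simp add: case_prod_beta' fun_eq_iff)
  note both = tilts_exchange[OF t G, of "\<lambda>(x, y). (x - 1, y - 1)" "\<lambda>(x, y). (x + 1, y + 1)"]
  note alone = tilts_exchange[OF tilts_diff[OF t' t] G, of "\<lambda>(x, y). (x, y - 1)" "\<lambda>(x, y). (x, y + 1)"]
  show "(\<integral>z. bond_gen (\<lambda>y z. g y) no_rate G z \<partial>pair_pmf A B)
      = (\<Sum>(c, A', B')\<leftarrow>[(c, A, B'), (- c', A', B), (c' - c, A2, B2)]. c * (\<integral>z. G z \<partial>pair_pmf A' B'))"
    unfolding eq Bochner_Integration.integral_add[OF both(1) alone(1)] both(2) alone(2) assms(3-6)
    by (simp add: algebra_simps)
qed

text \<open>
  The mirror image: when the rate depends on the target site only and decreases there, the lower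
  configuration is the one that jumps more often.
\<close>

lemma bond_law_target_rate:
  assumes lower: "tilts (\<lambda>x. g (fst x)) B c' B'" and upper: "tilts (\<lambda>x. g (snd x)) B c B'"
    and "map_pmf (\<lambda>(x, y). (x - 1, y - 1)) A = A'" "map_pmf (\<lambda>(x, y). (x + 1, y + 1)) B' = B"
    and "map_pmf (\<lambda>(x, y). (x - 1, y)) A = A2" "map_pmf (\<lambda>(x, y). (x + 1, y)) B' = B2"
  shows "bond_law (\<lambda>y z. g z) no_rate A B [(c, A', B), (- c', A, B'), (c' - c, A2, B2)]"
  unfolding bond_law_def
proof (intro conjI allI impI)
  note t' = tilts_pair_snd[OF lower, of A] and t = tilts_pair_snd[OF upper, of A]
  have "integrable (pair_pmf A B) (\<lambda>z. g (fst (snd z)))"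
    "integrable (pair_pmf A B) (\<lambda>z. g (snd (snd z)))"
    using tilts_integrable[OF t, of "\<lambda>_. 1"] tilts_integrable[OF t', of "\<lambda>_. 1"] by auto
  thus "integrable (pair_pmf A B) (bond_rate (\<lambda>y z. g z) no_rate)"
    unfolding bond_rate_def no_rate_def by (simp add: case_prod_beta')
  fix G :: "site \<times> site \<Rightarrow> real" assume G: "bounded (range G)"
  have eq: "bond_gen (\<lambda>y z. g z) no_rate G
      = (\<lambda>z. g (snd (snd z)) * (G ((\<lambda>(x, y). (x - 1, y - 1)) (fst z), (\<lambda>(x, y). (x + 1, y + 1)) (snd z)) - G z)
      + (g (fst (snd z)) - g (snd (snd z)))
        * (G ((\<lambda>(x, y). (x - 1, y)) (fst z), (\<lambda>(x, y). (x + 1, y)) (snd z)) - G z))"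
    unfolding bond_gen_def no_rate_def by (simp add: case_prod_beta' fun_eq_iff)
  note both = tilts_exchange[OF t G, of "\<lambda>(x, y). (x - 1, y - 1)" "\<lambda>(x, y). (x + 1, y + 1)"]
  note alone = tilts_exchange[OF tilts_diff[OF t' t] G, of "\<lambda>(x, y). (x - 1, y)" "\<lambda>(x, y). (x + 1, y)"]
  show "(\<integral>z. bond_gen (\<lambda>y z. g z) no_rate G z \<partial>pair_pmf A B)
      = (\<Sum>(c, A', B')\<leftarrow>[(c, A', B), (- c', A, B'), (c' - c, A2, B2)]. c * (\<integral>z. G z \<partial>pair_pmf A' B'))"
    unfolding eq Bochner_Integration.integral_add[OF both(1) alone(1)] both(2) alone(2) assms(3-6)
    by (simp add: algebra_simps)
qed

lemma pmf_eqI_proportional: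
  assumes "\<And>x. pmf A x = c * pmf B x"
  shows "A = B"
proof -
  have "1 = (\<integral>x. pmf A x \<partial>count_space UNIV)" by (simp add: integral_pmf)
  also have "\<dots> = c" by (simp add: assms integral_pmf)
  finally show ?thesis by (intro pmf_eqI) (simp add: assms)
qed

text \<open>
  Completing the square: a translation by one amounts to a change of the parameter by \<open>\<beta>\<close>.
\<close>

lemma gauss_weight_shift:
  "gauss_weight \<beta> (\<theta> + \<beta>) (z + 1) = exp (\<theta> + \<beta> / 2) * gauss_weight \<beta> \<theta> z"
  unfolding gauss_weight_def exp_add[symmetric] by (simp add: field_simps power2_eq_square)

lemma gauss_marginal_shift:
  assumes "\<beta> > 0"
  shows "map_pmf (\<lambda>z. z + 1) (gauss_marginal \<beta> \<theta>) = gauss_marginal \<beta> (\<theta> + \<beta>)"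
proof (rule pmf_eqI_proportional)
  fix z :: int
  have "pmf (map_pmf (\<lambda>z. z + 1) (gauss_marginal \<beta> \<theta>)) ((z - 1) + 1) = pmf (gauss_marginal \<beta> \<theta>) (z - 1)"
    by (rule pmf_map_inj') (simp add: inj_def)
  also have "gauss_norm \<beta> (\<theta> + \<beta>) \<noteq> 0"
  proof
    assume "gauss_norm \<beta> (\<theta> + \<beta>) = 0"
    hence "pmf (gauss_marginal \<beta> (\<theta> + \<beta>)) x = 0" for x
      by (simp add: pmf_gauss_marginal[OF assms])
    thus False by (metis pmf_eq_0_set_pmf set_pmf_not_empty ex_in_conv)
  qed
  hence "pmf (gauss_marginal \<beta> \<theta>) (z - 1)
     = (exp (- (\<theta> + \<beta> / 2)) * gauss_norm \<beta> (\<theta> + \<beta>) / gauss_norm \<beta> \<theta>) * pmf (gauss_marginal \<beta> (\<theta> + \<beta>)) z"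
    using gauss_weight_shift[of \<beta> \<theta> "z - 1"]
    by (simp add: pmf_gauss_marginal[OF assms] exp_minus field_simps)
  finally show "pmf (map_pmf (\<lambda>z. z + 1) (gauss_marginal \<beta> \<theta>)) z
     = (exp (- (\<theta> + \<beta> / 2)) * gauss_norm \<beta> (\<theta> + \<beta>) / gauss_norm \<beta> \<theta>) * pmf (gauss_marginal \<beta> (\<theta> + \<beta>)) z"
    by simp
qed

lemma gauss_marginal_shift_down:
  assumes "\<beta> > 0"
  shows "map_pmf (\<lambda>z. z - 1) (gauss_marginal \<beta> \<theta>) = gauss_marginal \<beta> (\<theta> - \<beta>)"
  using gauss_marginal_shift[OF assms, of "\<theta> - \<beta>", symmetric] by (simp add: map_pmf_comp)

lemma gauss_marginal_rate_up:
  assumes "\<beta> > 0"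
  shows "exp_rate \<beta> z * pmf (gauss_marginal \<beta> \<theta>) z = exp \<theta> * pmf (gauss_marginal \<beta> (\<theta> + \<beta>)) z"
proof -
  have "pmf (gauss_marginal \<beta> (\<theta> + \<beta>)) ((z - 1) + 1) = pmf (gauss_marginal \<beta> \<theta>) (z - 1)"
    unfolding gauss_marginal_shift[OF assms, symmetric] by (rule pmf_map_inj') (simp add: inj_def)
  moreover have "exp_rate \<beta> z * gauss_weight \<beta> \<theta> z = exp \<theta> * gauss_weight \<beta> \<theta> (z - 1)"
    unfolding exp_rate_def gauss_weight_def exp_add[symmetric]
    by (simp add: field_simps power2_eq_square)
  ultimately show ?thesis by (simp add: pmf_gauss_marginal[OF assms])
qed

lemma gauss_marginal_rate_down:
  assumes "\<beta> > 0"
  shows "exp_rate \<beta> (- z) * pmf (gauss_marginal \<beta> \<theta>) z = exp (- \<theta>) * pmf (gauss_marginal \<beta> (\<theta> - \<beta>)) z"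
proof -
  have "pmf (gauss_marginal \<beta> (\<theta> - \<beta>)) ((z + 1) - 1) = pmf (gauss_marginal \<beta> \<theta>) (z + 1)"
    unfolding gauss_marginal_shift_down[OF assms, symmetric] by (rule pmf_map_inj') (simp add: inj_def)
  moreover have "exp_rate \<beta> (- z) * gauss_weight \<beta> \<theta> z = exp (- \<theta>) * gauss_weight \<beta> \<theta> (z + 1)"
    unfolding exp_rate_def gauss_weight_def exp_add[symmetric]
    by (simp add: field_simps power2_eq_square)
  ultimately show ?thesis by (simp add: pmf_gauss_marginal[OF assms])
qed

section \<open>The three models\<close>

context
  fixes \<beta> :: real
  assumes \<beta>: "\<beta> > 0"
begin

private abbreviation "D \<theta> \<equiv> diag (gauss_marginal \<beta> \<theta>)"
private abbreviation "X \<theta> \<equiv> discrepancy (gauss_marginal \<beta> \<theta>)"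

text \<open>
  The last four identities are the reason why the shock keeps its shape. A jump of one configuration
  alone moves the discrepancy, and after it the site that is left carries the coupled marginal of
  a phase, and the site that is reached carries the discrepancy over \<open>\<mu>\<^sup>\<sigma>\<close>, provided that
  the parameters of the two phases differ by \<open>\<beta>\<close>.
\<close>

lemma gauss_site_shifts:
  "map_pmf (\<lambda>(x, y). (x - 1, y - 1)) (D \<theta>) = D (\<theta> - \<beta>)"
  "map_pmf (\<lambda>(x, y). (x + 1, y + 1)) (D \<theta>) = D (\<theta> + \<beta>)"
  "map_pmf (\<lambda>(x, y). (x - 1, y - 1)) (X \<theta>) = X (\<theta> - \<beta>)"
  "map_pmf (\<lambda>(x, y). (x + 1, y + 1)) (X \<theta>) = X (\<theta> + \<beta>)"
  "map_pmf (\<lambda>(x, y). (x, y - 1)) (X \<theta>) = D \<theta>"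
  "map_pmf (\<lambda>(x, y). (x, y + 1)) (D \<theta>) = X \<theta>"
  "map_pmf (\<lambda>(x, y). (x - 1, y)) (D \<theta>) = X (\<theta> - \<beta>)"
  "map_pmf (\<lambda>(x, y). (x + 1, y)) (X \<theta>) = D (\<theta> + \<beta>)"
  unfolding gauss_marginal_shift[OF \<beta>, symmetric] gauss_marginal_shift_down[OF \<beta>, symmetric]
  by (simp_all add: diag_def discrepancy_def map_pmf_comp add.commute)

text \<open>
  On the discrepancy the rate of the upper configuration, \<open>f(x + 1) = e\<^sup>\<beta> f(x)\<close>, gives the same
  tilted law as that of the lower one, with the constant of the other phase.
\<close>

lemma gauss_site_tilts_up:
  "tilts (\<lambda>x. exp_rate \<beta> (fst x)) (D \<theta>) (exp \<theta>) (D (\<theta> + \<beta>))"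
  "tilts (\<lambda>x. exp_rate \<beta> (snd x)) (D \<theta>) (exp \<theta>) (D (\<theta> + \<beta>))"
  "tilts (\<lambda>x. exp_rate \<beta> (fst x)) (X \<theta>) (exp \<theta>) (X (\<theta> + \<beta>))"
  "tilts (\<lambda>x. exp_rate \<beta> (snd x)) (X \<theta>) (exp (\<theta> + \<beta>)) (X (\<theta> + \<beta>))"
proof -
  have "exp_rate \<beta> (z + 1) = exp \<beta> * exp_rate \<beta> z" for z
    unfolding exp_rate_def exp_add[symmetric] by (simp add: algebra_simps)
  thus "tilts (\<lambda>x. exp_rate \<beta> (snd x)) (X \<theta>) (exp (\<theta> + \<beta>)) (X (\<theta> + \<beta>))"
    unfolding discrepancy_def
    by (intro tilts_map) (simp_all add: inj_def gauss_marginal_rate_up[OF \<beta>] exp_add mult.assoc)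
qed (unfold diag_def discrepancy_def,
    (intro tilts_map; simp add: inj_def gauss_marginal_rate_up[OF \<beta>])+)

lemma gauss_site_tilts_down:
  "tilts (\<lambda>x. exp_rate \<beta> (- fst x)) (D \<theta>) (exp (- \<theta>)) (D (\<theta> - \<beta>))"
  "tilts (\<lambda>x. exp_rate \<beta> (- snd x)) (D \<theta>) (exp (- \<theta>)) (D (\<theta> - \<beta>))"
  "tilts (\<lambda>x. exp_rate \<beta> (- fst x)) (X \<theta>) (exp (- \<theta>)) (X (\<theta> - \<beta>))"
  "tilts (\<lambda>x. exp_rate \<beta> (- snd x)) (X \<theta>) (exp (- (\<theta> + \<beta>))) (X (\<theta> - \<beta>))"
proof -
  have "exp_rate \<beta> (- (z + 1)) = exp (- \<beta>) * exp_rate \<beta> (- z)" for z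
    unfolding exp_rate_def exp_add[symmetric] by (simp add: algebra_simps)
  moreover have "exp (- (\<theta> + \<beta>)) = exp (- \<beta>) * exp (- \<theta>)"
    unfolding exp_add[symmetric] by simp
  ultimately show "tilts (\<lambda>x. exp_rate \<beta> (- snd x)) (X \<theta>) (exp (- (\<theta> + \<beta>))) (X (\<theta> - \<beta>))"
    unfolding discrepancy_def
    by (intro tilts_map)
       (simp_all only: inj_def gauss_marginal_rate_down[OF \<beta>] snd_conv mult.assoc, simp)
qed (unfold diag_def discrepancy_def,
    (intro tilts_map; simp add: inj_def gauss_marginal_rate_down[OF \<beta>])+)

text \<open>
  In the first law the target may have any marginal, since the rate does not look at it; it is
  used both inside a phase and in front of the discrepancy.
\<close>

lemma source_rate_bond_laws:
  "bond_law (\<lambda>y z. exp_rate \<beta> y) no_rate (D \<theta>) B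
     [(exp \<theta>, D \<theta>, map_pmf (\<lambda>(x, y). (x + 1, y + 1)) B), (- exp \<theta>, D (\<theta> + \<beta>), B)]"
  "bond_law (\<lambda>y z. exp_rate \<beta> y) no_rate (X \<theta>) (D \<theta>)
     [(exp \<theta>, X \<theta>, D (\<theta> + \<beta>)), (- exp (\<theta> + \<beta>), X (\<theta> + \<beta>), D \<theta>),
      (exp (\<theta> + \<beta>) - exp \<theta>, D (\<theta> + \<beta>), X \<theta>)]"
proof -
  show "bond_law (\<lambda>y z. exp_rate \<beta> y) no_rate (D \<theta>) B
     [(exp \<theta>, D \<theta>, map_pmf (\<lambda>(x, y). (x + 1, y + 1)) B), (- exp \<theta>, D (\<theta> + \<beta>), B)]"
    using bond_law_source_rate[OF gauss_site_tilts_up(1,2) _ refl refl refl, of \<theta> B]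
    by (simp add: gauss_site_shifts bond_law_def)
  show "bond_law (\<lambda>y z. exp_rate \<beta> y) no_rate (X \<theta>) (D \<theta>)
     [(exp \<theta>, X \<theta>, D (\<theta> + \<beta>)), (- exp (\<theta> + \<beta>), X (\<theta> + \<beta>), D \<theta>),
      (exp (\<theta> + \<beta>) - exp \<theta>, D (\<theta> + \<beta>), X \<theta>)]"
    by (rule bond_law_source_rate[OF gauss_site_tilts_up(3,4)]) (simp_all add: gauss_site_shifts)
qed

lemma target_rate_bond_laws:
  "bond_law (\<lambda>y z. exp_rate \<beta> (- z)) no_rate A (D \<theta>)
     [(exp (- \<theta>), map_pmf (\<lambda>(x, y). (x - 1, y - 1)) A, D \<theta>), (- exp (- \<theta>), A, D (\<theta> - \<beta>))]"
  "bond_law (\<lambda>y z. exp_rate \<beta> (- z)) no_rate (D (\<theta> + \<beta>)) (X \<theta>)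
     [(exp (- (\<theta> + \<beta>)), D \<theta>, X \<theta>), (- exp (- \<theta>), D (\<theta> + \<beta>), X (\<theta> - \<beta>)),
      (exp (- \<theta>) - exp (- (\<theta> + \<beta>)), X \<theta>, D \<theta>)]"
proof -
  show "bond_law (\<lambda>y z. exp_rate \<beta> (- z)) no_rate A (D \<theta>)
     [(exp (- \<theta>), map_pmf (\<lambda>(x, y). (x - 1, y - 1)) A, D \<theta>), (- exp (- \<theta>), A, D (\<theta> - \<beta>))]"
    using bond_law_target_rate[where g = "\<lambda>z. exp_rate \<beta> (- z)",
        OF gauss_site_tilts_down(1,2) refl _ refl refl, of \<theta> A]
    by (simp add: gauss_site_shifts bond_law_def)
  show "bond_law (\<lambda>y z. exp_rate \<beta> (- z)) no_rate (D (\<theta> + \<beta>)) (X \<theta>)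
     [(exp (- (\<theta> + \<beta>)), D \<theta>, X \<theta>), (- exp (- \<theta>), D (\<theta> + \<beta>), X (\<theta> - \<beta>)),
      (exp (- \<theta>) - exp (- (\<theta> + \<beta>)), X \<theta>, D \<theta>)]"
    by (rule bond_law_target_rate[where g = "\<lambda>z. exp_rate \<beta> (- z)", OF gauss_site_tilts_down(3,4)])
       (simp_all add: gauss_site_shifts)
qed

text \<open>
  The constants are the tilting constants of the two phases. The upper configuration drops the
  discrepancy to the right with the difference of the two rates, \<open>e\<^sup>\<sigma>\<^sup>+\<^sup>\<beta> - e\<^sup>\<sigma>\<close>.
\<close>

lemma source_rate_shock_evolution:
  fixes \<sigma> :: real
  defines "\<nu> \<equiv> shock_measure (gauss_marginal \<beta> (\<sigma> + \<beta>)) (gauss_marginal \<beta> \<sigma>) (gauss_marginal \<beta> \<sigma>)"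
  assumes \<phi>: "test_function \<phi>"
  shows "integrable (\<nu> j) (coupled_gen (\<lambda>y z. exp_rate \<beta> y) no_rate \<phi>)"
    and "(\<integral>z. coupled_gen (\<lambda>y z. exp_rate \<beta> y) no_rate \<phi> z \<partial>\<nu> j)
       = (exp (\<sigma> + \<beta>) - exp \<sigma>) * ((\<integral>z. \<phi> z \<partial>\<nu> (j + 1)) - (\<integral>z. \<phi> z \<partial>\<nu> j))"
proof -
  note laws = source_rate_bond_laws(1)[of "\<sigma> + \<beta>" "D (\<sigma> + \<beta>)"] source_rate_bond_laws(1)[of \<sigma> "D \<sigma>"]
    source_rate_bond_laws(1)[of "\<sigma> + \<beta>" "X \<sigma>"] source_rate_bond_laws(2)[of \<sigma>]
  note ev = shock_evolution[where a = "exp (\<sigma> + \<beta>)" and b = "exp \<sigma>" and w = "exp (\<sigma> + \<beta>)"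
      and u = 0 and v = 0 and Q = 0 and P = "exp (\<sigma> + \<beta>) - exp \<sigma>"
      and L' = "D (\<sigma> + \<beta> + \<beta>)" and R' = "D (\<sigma> + \<beta>)" and C' = "X (\<sigma> + \<beta>)"
      and left = "gauss_marginal \<beta> (\<sigma> + \<beta>)" and right = "gauss_marginal \<beta> \<sigma>"
      and hat = "gauss_marginal \<beta> \<sigma>" and p = "\<lambda>y z. exp_rate \<beta> y" and q = no_rate]
  show "integrable (\<nu> j) (coupled_gen (\<lambda>y z. exp_rate \<beta> y) no_rate \<phi>)"
    unfolding \<nu>_def
    by (rule ev(1)) (use laws \<phi> in \<open>simp_all add: bond_law_def gauss_site_shifts algebra_simps\<close>)
  show "(\<integral>z. coupled_gen (\<lambda>y z. exp_rate \<beta> y) no_rate \<phi> z \<partial>\<nu> j)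
       = (exp (\<sigma> + \<beta>) - exp \<sigma>) * ((\<integral>z. \<phi> z \<partial>\<nu> (j + 1)) - (\<integral>z. \<phi> z \<partial>\<nu> j))"
    unfolding \<nu>_def
    by (subst ev(2)) (use laws \<phi> in \<open>simp_all add: bond_law_def gauss_site_shifts algebra_simps\<close>)
qed

text \<open>
  Since the rate decreases in the occupation of the target, the tilts now remove a particle, the
  constants change sign, and the lower configuration catches up with the discrepancy from the left.
\<close>

lemma target_rate_shock_evolution:
  fixes \<sigma> :: real
  defines "\<nu> \<equiv> shock_measure (gauss_marginal \<beta> (\<sigma> + \<beta>)) (gauss_marginal \<beta> \<sigma>) (gauss_marginal \<beta> \<sigma>)"
  assumes \<phi>: "test_function \<phi>"
  shows "integrable (\<nu> j) (coupled_gen (\<lambda>y z. exp_rate \<beta> (- z)) no_rate \<phi>)"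
    and "(\<integral>z. coupled_gen (\<lambda>y z. exp_rate \<beta> (- z)) no_rate \<phi> z \<partial>\<nu> j)
       = (exp (- \<sigma>) - exp (- (\<sigma> + \<beta>))) * ((\<integral>z. \<phi> z \<partial>\<nu> (j - 1)) - (\<integral>z. \<phi> z \<partial>\<nu> j))"
proof -
  note laws = target_rate_bond_laws(1)[of "D (\<sigma> + \<beta>)" "\<sigma> + \<beta>"] target_rate_bond_laws(1)[of "D \<sigma>" \<sigma>]
    target_rate_bond_laws(1)[of "X \<sigma>" \<sigma>] target_rate_bond_laws(2)[of \<sigma>]
  note ev = shock_evolution[where a = "- exp (- (\<sigma> + \<beta>))" and b = "- exp (- \<sigma>)" and w = "- exp (- \<sigma>)"
      and u = 0 and v = 0 and P = 0 and Q = "exp (- \<sigma>) - exp (- (\<sigma> + \<beta>))"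
      and L' = "D \<sigma>" and R' = "D (\<sigma> - \<beta>)" and C' = "X (\<sigma> - \<beta>)"
      and left = "gauss_marginal \<beta> (\<sigma> + \<beta>)" and right = "gauss_marginal \<beta> \<sigma>"
      and hat = "gauss_marginal \<beta> \<sigma>" and p = "\<lambda>y z. exp_rate \<beta> (- z)" and q = no_rate]
  show "integrable (\<nu> j) (coupled_gen (\<lambda>y z. exp_rate \<beta> (- z)) no_rate \<phi>)"
    unfolding \<nu>_def
    by (rule ev(1)) (use laws \<phi> in \<open>simp_all add: bond_law_def gauss_site_shifts algebra_simps\<close>)
  show "(\<integral>z. coupled_gen (\<lambda>y z. exp_rate \<beta> (- z)) no_rate \<phi> z \<partial>\<nu> j)
       = (exp (- \<sigma>) - exp (- (\<sigma> + \<beta>))) * ((\<integral>z. \<phi> z \<partial>\<nu> (j - 1)) - (\<integral>z. \<phi> z \<partial>\<nu> j))"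
    unfolding \<nu>_def
    by (subst ev(2)) (use laws \<phi> in \<open>simp_all add: bond_law_def gauss_site_shifts algebra_simps\<close>)
qed

lemma gzrp_shock_identity:
  "shock_identity (gzrp_p \<beta>) no_rate
     (shock_measure (gauss_marginal \<beta> (\<sigma> + \<beta>)) (gauss_marginal \<beta> \<sigma>) (gauss_marginal \<beta> \<sigma>))
     (exp (\<sigma> + \<beta>) - exp \<sigma>) 0"
proof -
  have p: "gzrp_p \<beta> = (\<lambda>y z. exp_rate \<beta> y)" by (simp add: gzrp_p_def fun_eq_iff)
  show ?thesis unfolding p
    by (rule shock_identityI) (simp_all add: source_rate_shock_evolution)
qed

lemma blp_shock_identity:
  "shock_identity (blp_p \<beta>) no_rate
     (shock_measure (gauss_marginal \<beta> (\<sigma> + \<beta>)) (gauss_marginal \<beta> \<sigma>) (gauss_marginal \<beta> \<sigma>))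
     (exp (\<sigma> + \<beta>) - exp \<sigma>) (exp (- \<sigma>) - exp (- (\<sigma> + \<beta>)))"
proof -
  have p: "blp_p \<beta> = (\<lambda>y z. exp_rate \<beta> y + exp_rate \<beta> (- z))" by (simp add: blp_p_def fun_eq_iff)
  have "coupled_gen (blp_p \<beta>) no_rate \<phi> = (\<lambda>x. coupled_gen (\<lambda>y z. exp_rate \<beta> y) no_rate \<phi> x
      + coupled_gen (\<lambda>y z. exp_rate \<beta> (- z)) no_rate \<phi> x)" if "test_function \<phi>" for \<phi>
    unfolding p using coupled_gen_add that by (auto simp: test_function_def)
  thus ?thesis
    by (intro shock_identityI)
       (simp_all add: source_rate_shock_evolution target_rate_shock_evolution)
qed

end

lemma expectation_pair_finite:
  fixes H :: "'a \<times> 'b \<Rightarrow> real"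
  assumes "finite (set_pmf A)" "finite (set_pmf B)"
  shows "(\<integral>z. H z \<partial>pair_pmf A B) = (\<integral>x. (\<integral>y. H (x, y) \<partial>B) \<partial>A)"
proof -
  have "(\<integral>z. H z \<partial>pair_pmf A B) = (\<Sum>z\<in>set_pmf A \<times> set_pmf B. H z * pmf (pair_pmf A B) z)"
    using assms by (intro integral_measure_pmf_real) auto
  also have "\<dots> = (\<Sum>x\<in>set_pmf A. (\<Sum>y\<in>set_pmf B. H (x, y) * pmf B y) * pmf A x)"
    by (simp add: sum.cartesian_product' pmf_pair sum_distrib_left sum_distrib_right mult_ac)
  also have "\<dots> = (\<Sum>x\<in>set_pmf A. (\<integral>y. H (x, y) \<partial>B) * pmf A x)"
    using assms(2) by (intro sum.cong refl arg_cong2[where f = times] integral_measure_pmf_real[symmetric]) auto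
  also have "\<dots> = (\<integral>x. (\<integral>y. H (x, y) \<partial>B) \<partial>A)"
    using assms(1) by (intro integral_measure_pmf_real[symmetric]) auto
  finally show ?thesis .
qed

context
  fixes \<rho> :: real
  assumes \<rho>: "0 < \<rho>" "\<rho> < 1"
begin

lemma expectation_diag_asep:
  fixes H :: "site \<Rightarrow> real"
  shows "(\<integral>x. H x \<partial>diag (asep_marginal \<rho>)) = (1 - \<rho>) * H (0, 0) + \<rho> * H (1, 1)"
  using \<rho> by (simp add: diag_def asep_marginal_def)

lemma finite_set_diag_asep: "finite (set_pmf (diag (asep_marginal \<rho>)))"
  by (simp add: diag_def asep_marginal_def)

end

text \<open>
  The tilted marginal of both phases is a particle pinned at the site. The discrepancy is not tilted,
  since the lower and the upper state are forced to \<open>0\<close> and \<open>1\<close> there, so \<open>w = 0\<close>. It leaves to the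
  right with rate \<open>p\<close> from a configuration with an empty right neighbour and \<open>q\<close> with an occupied one,
  that is, with rate \<open>p\<close> diminished by \<open>p - q\<close> on occupation of the neighbour; the first part gives
  \<open>v = p\<close> and the second is a tilt of the right phase. To the left \<open>u = q\<close> arises in the same way. The
  hypotheses on \<open>P\<close> and \<open>Q\<close> say that the site the discrepancy leaves behind is distributed as in the
  phase that takes it over.
\<close>

lemma asep_shock_identity:
  fixes p q \<rho> lam P Q :: real
  assumes \<rho>: "0 < \<rho>" "\<rho> < 1" and lam: "0 < lam" "lam < 1"
    and P: "P * (1 - \<rho>) = p * (1 - lam)" "P * \<rho> = q * lam"
    and Q: "Q * (1 - lam) = q * (1 - \<rho>)" "Q * lam = p * \<rho>"
  shows "shock_identity (asep_p p) (asep_q q)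
     (shock_measure (asep_marginal \<rho>) (asep_marginal lam) (return_pmf 0)) P Q"
proof -
  let ?D = "\<lambda>\<rho>. diag (asep_marginal \<rho>)" and ?C = "discrepancy (return_pmf 0)"
  let ?one = "return_pmf (1, 1) :: site pmf"
  have C: "?C = return_pmf (0, 1)" by (simp add: discrepancy_def)
  have P': "P * ((1 - \<rho>) * x + \<rho> * y) = p * (1 - lam) * x + q * lam * y"
    and Q': "Q * ((1 - lam) * x + lam * y) = q * (1 - \<rho>) * x + p * \<rho> * y" for x y
    by (simp_all add: distrib_left P Q flip: mult.assoc)
  note fin = finite_set_diag_asep[OF \<rho>] finite_set_diag_asep[OF lam]
  note ex = expectation_diag_asep[OF \<rho>] expectation_diag_asep[OF lam]
  note simps = bond_law_def C expectation_pair_finite fin ex integrable_measure_pmf_finite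
    bond_gen_def asep_p_def asep_q_def
  have "bond_law (asep_p p) (asep_q q) (?D \<rho>) (?D \<rho>)
      [((p - q) * \<rho>, ?D \<rho>, ?one), (- ((p - q) * \<rho>), ?one, ?D \<rho>)]"
    by (simp add: simps) (simp add: algebra_simps)
  moreover have "bond_law (asep_p p) (asep_q q) (?D lam) (?D lam)
      [((p - q) * lam, ?D lam, ?one), (- ((p - q) * lam), ?one, ?D lam)]"
    by (simp add: simps) (simp add: algebra_simps)
  moreover have "bond_law (asep_p p) (asep_q q) (?D \<rho>) ?C
      [(Q, ?C, ?D lam), (- ((p - q) * \<rho>), ?one, ?C), (0, ?D \<rho>, ?C), (- q, ?D \<rho>, ?C)]"
    by (simp add: simps Q') (simp add: algebra_simps)
  moreover have "bond_law (asep_p p) (asep_q q) ?C (?D lam)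
      [(P, ?D \<rho>, ?C), ((p - q) * lam, ?C, ?one), (- 0, ?C, ?D lam), (- p, ?C, ?D lam)]"
    by (simp add: simps P') (simp add: algebra_simps)
  ultimately show ?thesis
    by (intro shock_identityI) (rule shock_evolution; assumption)+
qed

theorem theorem3p1:
  shows
    "(\<forall>p q \<rho> lam :: real. \<forall>hat :: int pmf.
        0 < q \<and> q < p \<and> p + q = 1 \<and> 0 < \<rho> \<and> \<rho> < 1 \<and> 0 < lam \<and> lam < 1 \<and>
        lam * (1 - \<rho>) / (\<rho> * (1 - lam)) = p / q \<and> pmf hat 0 = 1 \<longrightarrow>
        (\<exists>P Q.
           P = (1 - lam) / (1 - \<rho>) * p \<and> P = lam / \<rho> * q \<and> P = (1 - lam) * p + lam * q \<and>
           Q = (1 - \<rho>) / (1 - lam) * q \<and> Q = \<rho> / lam * p \<and> Q = (1 - \<rho>) * q + \<rho> * p \<and>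
           shock_identity (asep_p p) (asep_q q)
             (shock_measure (asep_marginal \<rho>) (asep_marginal lam) hat) P Q))
   \<and> (\<forall>\<beta> \<theta> \<sigma> :: real. \<forall>hat :: int pmf.
        0 < \<beta> \<and> \<theta> - \<sigma> = \<beta> \<and> (\<forall>y. pmf hat y = pmf (gauss_marginal \<beta> \<sigma>) y) \<longrightarrow>
        shock_identity (gzrp_p \<beta>) no_rate
          (shock_measure (gauss_marginal \<beta> \<theta>) (gauss_marginal \<beta> \<sigma>) hat)
          (exp \<theta> - exp \<sigma>) 0)
   \<and> (\<forall>\<beta> \<theta> \<sigma> :: real. \<forall>hat :: int pmf.
        0 < \<beta> \<and> \<theta> - \<sigma> = \<beta> \<and> (\<forall>y. pmf hat y = pmf (gauss_marginal \<beta> \<sigma>) y) \<longrightarrow>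
        shock_identity (blp_p \<beta>) no_rate
          (shock_measure (gauss_marginal \<beta> \<theta>) (gauss_marginal \<beta> \<sigma>) hat)
          (exp \<theta> - exp \<sigma>) (exp (- \<sigma>) - exp (- \<theta>)))"
proof (intro conjI allI impI; elim conjE)
  fix p q \<rho> lam :: real and hat :: "int pmf"
  assume *: "0 < q" "q < p" "p + q = 1" "0 < \<rho>" "\<rho> < 1" "0 < lam" "lam < 1"
    and ratio: "lam * (1 - \<rho>) / (\<rho> * (1 - lam)) = p / q" and hat: "pmf hat 0 = 1"
  have "AE x in measure_pmf hat. x \<in> {0}"
    using hat measure_pmf.prob_eq_1[of "{0}" hat] by (simp add: measure_pmf_single)
  hence hat: "hat = return_pmf 0"
    unfolding set_pmf_subset_singleton[symmetric] AE_measure_pmf_iff by auto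
  \<comment> \<open>the third expression for each speed is taken as its definition; the other two follow from this product form of the density relation\<close>
  have bal: "lam * (1 - \<rho>) * q = p * (\<rho> * (1 - lam))"
    using ratio * by (simp add: frac_eq_eq)
  define P Q where "P = (1 - lam) * p + lam * q" and "Q = (1 - \<rho>) * q + \<rho> * p"
  have P: "P * (1 - \<rho>) = p * (1 - lam)" "P * \<rho> = q * lam"
    and Q: "Q * (1 - lam) = q * (1 - \<rho>)" "Q * lam = p * \<rho>"
    using bal unfolding P_def Q_def by (auto simp: algebra_simps)
  show "\<exists>P Q. P = (1 - lam) / (1 - \<rho>) * p \<and> P = lam / \<rho> * q \<and> P = (1 - lam) * p + lam * q \<and>
           Q = (1 - \<rho>) / (1 - lam) * q \<and> Q = \<rho> / lam * p \<and> Q = (1 - \<rho>) * q + \<rho> * p \<and>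
           shock_identity (asep_p p) (asep_q q)
             (shock_measure (asep_marginal \<rho>) (asep_marginal lam) hat) P Q"
  proof (intro exI conjI)
    show "P = (1 - lam) / (1 - \<rho>) * p" "P = lam / \<rho> * q" "Q = (1 - \<rho>) / (1 - lam) * q" "Q = \<rho> / lam * p"
      using P Q * by (simp_all add: eq_divide_eq mult.commute)
    show "P = (1 - lam) * p + lam * q" "Q = (1 - \<rho>) * q + \<rho> * p"
      by (fact P_def Q_def)+
    show "shock_identity (asep_p p) (asep_q q)
             (shock_measure (asep_marginal \<rho>) (asep_marginal lam) hat) P Q"
      unfolding hat using * P Q by (intro asep_shock_identity)
  qed
next
  fix \<beta> \<theta> \<sigma> :: real and hat :: "int pmf"
  assume "0 < \<beta>" "\<theta> - \<sigma> = \<beta>" and "\<forall>y. pmf hat y = pmf (gauss_marginal \<beta> \<sigma>) y"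
  moreover from this have "\<theta> = \<sigma> + \<beta>" "hat = gauss_marginal \<beta> \<sigma>"
    by (auto intro: pmf_eqI)
  ultimately show "shock_identity (gzrp_p \<beta>) no_rate
          (shock_measure (gauss_marginal \<beta> \<theta>) (gauss_marginal \<beta> \<sigma>) hat) (exp \<theta> - exp \<sigma>) 0"
    and "shock_identity (blp_p \<beta>) no_rate
          (shock_measure (gauss_marginal \<beta> \<theta>) (gauss_marginal \<beta> \<sigma>) hat)
          (exp \<theta> - exp \<sigma>) (exp (- \<sigma>) - exp (- \<theta>))"
    by (simp_all only: gzrp_shock_identity blp_shock_identity)
qed

end
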